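(* The map $\mathcal{F}:\mathcal{N}\to\mathrm{SPD}(d+1)$, $\mathcal{F}(p_\theta)=S(\theta)=\mathbb{E}_{p_\theta}[V(x)V(x)^\top]$, is a diffeomorphism onto its image $\mathcal{M}:=\mathcal{F}(\mathcal{N})\subset\mathrm{SPD}(d+1)$. Specifically: (i) $\mathcal{F}$ is injective. (ii) $\mathcal{F}$ is infinitely differentiable, $\mathcal{F}\in C^\infty(\mathcal{N},\mathrm{SPD}(d+1))$. (iii) The differential $D\mathcal{F}_{p_\theta}:T_{p_\theta}\mathcal{N}\to T_{S(\theta)}\mathrm{SPD}(d+1)$ has full rank $d$ at every $p_\theta\in\mathcal{N}$, so $\mathcal{F}$ is an immersion. (iv) $\mathcal{M}=\mathcal{F}(\mathcal{N})$ is a $d$-dimensional embedded submanifold of $\mathrm{SPD}(d+1)$, and $\mathcal{F}:\mathcal{N}\to\mathcal{M}$ is a diffeomorphism.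
   Context: Let $(X,\mathcal{X},\mu)$ be a $\sigma$-finite measure space and let $\mathcal{M}_\mu$ be the set of measurable $p:X\to\mathbb{R}$ with $p>0$ $\mu$-a.e. and $\int_X p\,d\mu=1$. For $p\in\mathcal{M}_\mu$ write $\mathbb{E}_p[u]=\int_X u\,p\,d\mu$ (entrywise for matrices). Fix a reference density $p\in\mathcal{M}_\mu$. Let $B_p$ be the Banach space of ($\mu$-a.e. classes of) measurable $u:X\to\mathbb{R}$ such that $\mathbb{E}_p[\cosh(\alpha u)-1]<\infty$ for some $\alpha>0$ and $\mathbb{E}_p[u]=0$, with norm $\|u\|_p=\inf\{r>0:\mathbb{E}_p[\cosh(u/r)-1]\le 1\}$. For $u\in B_p$ let $K_p(u)=\log\mathbb{E}_p[e^u]\in[0,+\infty]$, $\mathrm{Dom}(K_p)=\{u\in B_p:K_p(u)<\infty\}$, with interior $\mathrm{Dom}(K_p)^\circ$ in $B_p$. Fix $d\ge 1$ and $u_1,\ldots,u_d\in B_p$ linearly independent in $L^2(p\cdot\mu)$ (standing assumption). Let $\Theta=\{\theta\in\mathbb{R}^d:\sum_j\theta_ju_j\in\mathrm{Dom}(K_p)^\circ\}$ (open), $\psi(\theta)=K_p(\sum_j\theta_ju_j)$, $p_\theta=e^{\sum_j\theta_ju_j-\psi(\theta)}p$, and $\mathcal{N}=\{p_\theta:\theta\in\Theta\}$, regarded as a $d$-dimensional smooth manifold with global chart $p_\theta\mapsto\theta$, so $T_{p_\theta}\mathcal{N}\cong\mathbb{R}^d$. $V(x)=(u_1(x),\ldots,u_d(x),1)^\top\in\mathbb{R}^{d+1}$.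 $\mathrm{SPD}(m)$ denotes the set of real symmetric positive definite $m\times m$ matrices, an open subset of the space $\mathrm{Sym}(m)$ of symmetric matrices; $T_S\mathrm{SPD}(m)\cong\mathrm{Sym}(m)$. *)

theory Defs
  imports "HOL-Analysis.Analysis"
begin

section \<open>Densities and the exponential Orlicz space\<close>

definition densities :: "'a measure \<Rightarrow> ('a \<Rightarrow> real) set" where
  "densities M =
     {p \<in> borel_measurable M. (AE x in M. p x > 0) \<and> has_bochner_integral M p 1}"

definition mean :: "'a measure \<Rightarrow> ('a \<Rightarrow> real) \<Rightarrow> ('a \<Rightarrow> real) \<Rightarrow> real" where
  "mean M p f = (\<integral>x. f x * p x \<partial>M)"

text \<open>The same expectation for a nonnegative integrand, with values in \<open>[0, \<infinity>]\<close>.\<close>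

definition nn_mean :: "'a measure \<Rightarrow> ('a \<Rightarrow> real) \<Rightarrow> ('a \<Rightarrow> real) \<Rightarrow> ennreal" where
  "nn_mean M p f = (\<integral>\<^sup>+x. ennreal (f x * p x) \<partial>M)"

text \<open>Elements of \<open>B\<^sub>p\<close> are represented by measurable functions, not by their
  almost-everywhere classes; all notions below are invariant under a.e. equality. In
  particular \<open>orlicz_norm\<close> is a seminorm on representatives, and \<open>cumulant_interior\<close> is
  the set of representatives of the interior of the domain in the Banach space of classes.\<close>

definition orlicz_space :: "'a measure \<Rightarrow> ('a \<Rightarrow> real) \<Rightarrow> ('a \<Rightarrow> real) set" where
  "orlicz_space M p =
     {u \<in> borel_measurable M.
        (\<exists>\<alpha>>0. nn_mean M p (\<lambda>x. cosh (\<alpha> * u x) - 1) < \<infinity>) \<and> mean M p u = 0}"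

definition orlicz_norm :: "'a measure \<Rightarrow> ('a \<Rightarrow> real) \<Rightarrow> ('a \<Rightarrow> real) \<Rightarrow> real" where
  "orlicz_norm M p u = Inf {r. r > 0 \<and> nn_mean M p (\<lambda>x. cosh (u x / r) - 1) \<le> 1}"

definition cumulant :: "'a measure \<Rightarrow> ('a \<Rightarrow> real) \<Rightarrow> ('a \<Rightarrow> real) \<Rightarrow> ereal" where
  "cumulant M p u =
     (let m = nn_mean M p (\<lambda>x. exp (u x)) in if m = \<infinity> then \<infinity> else ereal (ln (enn2real m)))"

definition cumulant_dom :: "'a measure \<Rightarrow> ('a \<Rightarrow> real) \<Rightarrow> ('a \<Rightarrow> real) set" where
  "cumulant_dom M p = {u \<in> orlicz_space M p. cumulant M p u < \<infinity>}"

definition cumulant_interior :: "'a measure \<Rightarrow> ('a \<Rightarrow> real) \<Rightarrow> ('a \<Rightarrow> real) set" where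
  "cumulant_interior M p =
     {u \<in> orlicz_space M p. \<exists>e>0. \<forall>v \<in> orlicz_space M p.
        orlicz_norm M p (\<lambda>x. v x - u x) < e \<longrightarrow> v \<in> cumulant_dom M p}"


section \<open>The exponential family\<close>

definition lin_comb :: "('d::finite \<Rightarrow> 'a \<Rightarrow> real) \<Rightarrow> real^'d \<Rightarrow> 'a \<Rightarrow> real" where
  "lin_comb u \<theta> x = (\<Sum>j\<in>UNIV. \<theta> $ j * u j x)"

text \<open>Linear independence in \<open>L\<^sup>2(p \<cdot> \<mu>)\<close>: the zero vector of that space is the class of
  functions vanishing \<open>p \<cdot> \<mu>\<close>-almost everywhere.\<close>

definition lin_indep_L2 :: "'a measure \<Rightarrow> ('a \<Rightarrow> real) \<Rightarrow> ('d::finite \<Rightarrow> 'a \<Rightarrow> real) \<Rightarrow> bool" where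
  "lin_indep_L2 M p u \<longleftrightarrow>
     (\<forall>c. (AE x in density M (\<lambda>x. ennreal (p x)). lin_comb u c x = 0) \<longrightarrow> c = 0)"

definition par_space ::
    "'a measure \<Rightarrow> ('a \<Rightarrow> real) \<Rightarrow> ('d::finite \<Rightarrow> 'a \<Rightarrow> real) \<Rightarrow> (real^'d) set" where
  "par_space M p u = {\<theta>. lin_comb u \<theta> \<in> cumulant_interior M p}"

definition log_partition ::
    "'a measure \<Rightarrow> ('a \<Rightarrow> real) \<Rightarrow> ('d::finite \<Rightarrow> 'a \<Rightarrow> real) \<Rightarrow> real^'d \<Rightarrow> real" where
  "log_partition M p u \<theta> = real_of_ereal (cumulant M p (lin_comb u \<theta>))"

definition fam_density ::
    "'a measure \<Rightarrow> ('a \<Rightarrow> real) \<Rightarrow> ('d::finite \<Rightarrow> 'a \<Rightarrow> real) \<Rightarrow> real^'d \<Rightarrow> 'a \<Rightarrow> real" where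
  "fam_density M p u \<theta> x = exp (lin_comb u \<theta> x - log_partition M p u \<theta>) * p x"

definition exp_family ::
    "'a measure \<Rightarrow> ('a \<Rightarrow> real) \<Rightarrow> ('d::finite \<Rightarrow> 'a \<Rightarrow> real) \<Rightarrow> ('a \<Rightarrow> real) set" where
  "exp_family M p u = fam_density M p u ` par_space M p u"

definition fam_chart ::
    "'a measure \<Rightarrow> ('a \<Rightarrow> real) \<Rightarrow> ('d::finite \<Rightarrow> 'a \<Rightarrow> real) \<Rightarrow> ('a \<Rightarrow> real) \<Rightarrow> real^'d" where
  "fam_chart M p u = inv_into (par_space M p u) (fam_density M p u)"


section \<open>The moment map\<close>

text \<open>The index type \<open>'d option\<close> has \<open>d + 1\<close> elements; \<open>None\<close> is the index of the last,
  constant coordinate.\<close>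

definition moment_vec :: "('d::finite \<Rightarrow> 'a \<Rightarrow> real) \<Rightarrow> 'a \<Rightarrow> real^('d option)" where
  "moment_vec u x = (\<chi> i. case i of Some j \<Rightarrow> u j x | None \<Rightarrow> 1)"

definition moment_map ::
    "'a measure \<Rightarrow> ('d::finite \<Rightarrow> 'a \<Rightarrow> real) \<Rightarrow> ('a \<Rightarrow> real) \<Rightarrow> real^('d option)^('d option)" where
  "moment_map M u q = (\<chi> i j. mean M q (\<lambda>x. moment_vec u x $ i * moment_vec u x $ j))"

definition sym_mat :: "(real^'n^'n) set" where
  "sym_mat = {A. transpose A = A}"

definition spd :: "(real^'n^'n) set" where
  "spd = {A \<in> sym_mat. \<forall>x. x \<noteq> 0 \<longrightarrow> x \<bullet> (A *v x) > 0}"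


section \<open>Smooth maps and embedded submanifolds\<close>

text \<open>\<open>Ck_on k W f\<close> is intended for open \<open>W\<close> and a finite-dimensional domain, where
  continuity of all directional derivatives is the same as continuity of the derivative.\<close>

primrec Ck_on ::
    "nat \<Rightarrow> 'a::euclidean_space set \<Rightarrow> ('a \<Rightarrow> 'b::real_normed_vector) \<Rightarrow> bool" where
  "Ck_on 0 W f \<longleftrightarrow> continuous_on W f"
| "Ck_on (Suc k) W f \<longleftrightarrow>
     (\<forall>x\<in>W. f differentiable (at x)) \<and> (\<forall>v. Ck_on k W (\<lambda>x. frechet_derivative f (at x) v))"

text \<open>Smoothness on an arbitrary subset of a Euclidean space means local extendability to
  smooth maps on open sets. For open \<open>A\<close> it is the usual smoothness; it also covers (relatively)
  open subsets of a linear subspace and embedded submanifolds.\<close>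

definition smooth_on ::
    "'a::euclidean_space set \<Rightarrow> ('a \<Rightarrow> 'b::real_normed_vector) \<Rightarrow> bool" where
  "smooth_on A f \<longleftrightarrow>
     (\<forall>x\<in>A. \<exists>W g. open W \<and> x \<in> W \<and> (\<forall>k. Ck_on k W g) \<and> (\<forall>y\<in>A \<inter> W. g y = f y))"

definition diffeo_on ::
    "'a::euclidean_space set \<Rightarrow> 'b::euclidean_space set \<Rightarrow> ('a \<Rightarrow> 'b) \<Rightarrow> bool" where
  "diffeo_on A B f \<longleftrightarrow> bij_betw f A B \<and> smooth_on A f \<and> smooth_on B (inv_into A f)"

text \<open>\<open>N\<close> is a \<open>k\<close>-dimensional embedded submanifold of \<open>P\<close>, where \<open>P\<close> is an open subset of the
  linear subspace \<open>E\<close>: around each of its points there is a slice chart of \<open>P\<close>. The model space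
  of the charts is \<open>E\<close> itself instead of a coordinate space, and a \<open>k\<close>-dimensional linear
  subspace of \<open>E\<close> replaces the span of the first \<open>k\<close> coordinate axes.\<close>

definition embedded_submanifold ::
    "nat \<Rightarrow> 'a::euclidean_space set \<Rightarrow> 'a set \<Rightarrow> 'a set \<Rightarrow> bool" where
  "embedded_submanifold k E P N \<longleftrightarrow>
     N \<subseteq> P \<and>
     (\<forall>x\<in>N. \<exists>U W \<phi> L.
        x \<in> U \<and> U \<subseteq> P \<and> openin (top_of_set E) U \<and> openin (top_of_set E) W \<and>
        diffeo_on U W \<phi> \<and> subspace L \<and> L \<subseteq> E \<and> dim L = k \<and> \<phi> ` (U \<inter> N) = W \<inter> L)"

end

theory Submission
  imports Defs
begin

text \<open>The moment matrix contains the mean vector: its last column is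
  \<open>\<eta>(\<theta>) = (E\<^sub>\<theta> u\<^sub>1, \<dots>, E\<^sub>\<theta> u\<^sub>d)\<close>, the expectation under \<open>p\<^sub>\<theta>\<close>. Everything follows from
  the fact that \<open>\<eta>\<close> alone (\<open>mean_vec\<close> below) is a diffeomorphism from \<open>\<Theta>\<close> onto an open set \<open>H\<close>.
  Indeed, with \<open>\<pi>\<close> for the linear map that reads off the last column, \<open>\<pi> \<circ> S = \<eta>\<close>, where
  \<open>S(\<theta>)\<close> is the moment matrix. So \<open>S\<close> is injective and an immersion because \<open>\<eta>\<close> is; the smooth map
  \<open>\<eta>\<^sup>-\<^sup>1 \<circ> \<pi>\<close>, defined on an open set of matrices, inverts \<open>S\<close>; and the image of \<open>S\<close> is the image
  of the section \<open>S \<circ> \<eta>\<^sup>-\<^sup>1\<close> of \<open>\<pi>\<close> over \<open>H\<close>. The image of a smooth section is a graph, and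
  shearing the graph onto its base is a single global slice chart
  (\<open>embedded_submanifold_section\<close>).

  For \<open>\<eta>\<close> itself three facts are needed.

  Smoothness. The interior condition in the definition of \<open>\<Theta>\<close> makes \<open>\<Theta>\<close> open and gives, at each
  \<open>\<theta> \<in> \<Theta>\<close>, some \<open>a > 0\<close> such that \<open>exp(\<theta>\<cdot>u + a\<Sum>|u\<^sub>j|)\<close> is integrable
  (\<open>exp_lc_total_abs_integrable\<close>). This slack absorbs every factor of polynomial growth in \<open>u\<close>,
  so the integrals \<open>Z f \<theta> = E\<^sub>p[f exp(\<theta>\<cdot>u)]\<close> can be differentiated under the integral sign, and
  the derivative in direction \<open>v\<close> is the integral of the same kind for \<open>f\<cdot>(v\<cdot>u)\<close>
  (\<open>Z_has_derivative\<close>). Iteration gives smoothness of \<open>Z f\<close>, and expectations under \<open>p\<^sub>\<theta>\<close> are the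
  quotients \<open>Z f / Z 1\<close>.

  Invertible derivative. The derivative of \<open>\<eta>\<close> is the covariance matrix of \<open>u\<close> under \<open>p\<^sub>\<theta>\<close>. If
  \<open>v\<close> is in its kernel then \<open>v\<cdot>u\<close> has variance zero, hence is constant almost everywhere; the
  constant is \<open>0\<close> because \<open>E\<^sub>p u\<^sub>j = 0\<close>, and linear independence gives \<open>v = 0\<close>. The same argument
  shows that \<open>S(\<theta>)\<close> is positive definite.

  Injectivity. If \<open>\<eta>(\<theta>) = \<eta>(\<theta>')\<close>, then the symmetrised Kullback-Leibler divergence
  \<open>\<integral>(p\<^sub>\<theta>\<^sub>' - p\<^sub>\<theta>)(log p\<^sub>\<theta>\<^sub>' - log p\<^sub>\<theta>) = (\<theta>' - \<theta>)\<cdot>(\<eta>(\<theta>') - \<eta>(\<theta>))\<close> vanishes. Its integrand is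
  nonnegative and vanishes only where the two densities agree, so \<open>(\<theta>' - \<theta>)\<cdot>u\<close> is almost
  everywhere constant, and \<open>\<theta> = \<theta>'\<close> as before (\<open>inj_on_mean_vec\<close>).

  Since \<open>\<eta>\<close> is injective between spaces of the same dimension, invariance of domain provides the open
  image and the continuous inverse, and Cramer's rule shows that the derivative of the inverse is as
  smooth as the inverse itself, which bootstraps to smoothness (\<open>smooth_inverse\<close>).\<close>

section \<open>Two ways to find a derivative\<close>

lemma has_derivative_quadratic_remainder:
  fixes f :: "'a::real_normed_vector \<Rightarrow> 'b::real_normed_vector"
  assumes "bounded_linear D" "r > 0"
    and "\<And>h. norm h < r \<Longrightarrow> norm (f (x + h) - f x - D h) \<le> K * (norm h)\<^sup>2"
  shows "(f has_derivative D) (at x)"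
  unfolding has_derivative_at_alt
proof (intro conjI allI impI)
  fix e :: real assume "e > 0"
  define d where "d = min r (e / (\<bar>K\<bar> + 1))"
  have "norm (f y - f x - D (y - x)) \<le> e * norm (y - x)" if "norm (y - x) < d" for y
  proof -
    have "norm (f y - f x - D (y - x)) \<le> K * (norm (y - x))\<^sup>2"
      using assms(3)[of "y - x"] that by (simp add: d_def)
    also have "\<dots> \<le> (\<bar>K\<bar> + 1) * norm (y - x) * norm (y - x)"
      by (simp add: power2_eq_square mult.assoc mult_right_mono)
    also have "\<dots> \<le> e * norm (y - x)"
      using that by (intro mult_right_mono) (auto simp: d_def field_simps)
    finally show ?thesis .
  qed
  then show "\<exists>d>0. \<forall>y. norm (y - x) < d \<longrightarrow> norm (f y - f x - D (y - x)) \<le> e * norm (y - x)"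
    using \<open>e > 0\<close> \<open>r > 0\<close> by (intro exI[of _ d]) (auto simp: d_def)
qed (rule assms)

lemma has_derivative_vec_lambda:
  fixes f :: "'i::finite \<Rightarrow> 'a::real_normed_vector \<Rightarrow> real"
  assumes "\<And>i. (f i has_derivative f' i) (at x)"
  shows "((\<lambda>x. \<chi> i. f i x) has_derivative (\<lambda>v. \<chi> i. f' i v)) (at x)"
proof -
  have "bounded_linear (axis i :: real \<Rightarrow> real^'i)" for i
    unfolding linear_conv_bounded_linear[symmetric]
    by (auto intro!: linearI simp: vec_eq_iff axis_def)
  then have "((\<lambda>x. \<Sum>i\<in>UNIV. axis i (f i x)) has_derivative (\<lambda>v. \<Sum>i\<in>UNIV. axis i (f' i v))) (at x)"
    by (intro has_derivative_sum bounded_linear.has_derivative[OF _ assms])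
  moreover have "(\<Sum>i\<in>UNIV. axis i (g i)) = (\<chi> i. g i)" for g :: "'i \<Rightarrow> real"
    by (simp add: vec_eq_iff axis_def)
  ultimately show ?thesis by simp
qed

section \<open>Functions with continuous iterated derivatives\<close>

text \<open>\<open>Ck_on\<close> refers to full Frechet derivatives at the points of the set, so only on an open set is
  it determined by the values there.\<close>

lemma Ck_on_cong:
  assumes "open W" "\<And>x. x \<in> W \<Longrightarrow> f x = g x" "Ck_on k W f"
  shows "Ck_on k W g"
  using assms(2,3)
proof (induction k arbitrary: f g)
  case 0
  then show ?case by (simp cong: continuous_on_cong)
next
  case (Suc k)
  have diff: "f differentiable (at x)" if "x \<in> W" for x
    using Suc.prems that by simp
  have "g differentiable (at x)" if "x \<in> W" for x
    using diff[OF that] has_derivative_transform_within_open[where f = f and g = g, OF _ \<open>open W\<close> that]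
      Suc.prems(1)
    unfolding differentiable_def by blast
  moreover have "Ck_on k W (\<lambda>x. frechet_derivative g (at x) v)" for v
  proof (rule Suc.IH)
    show "Ck_on k W (\<lambda>x. frechet_derivative f (at x) v)"
      using Suc.prems by simp
    show "frechet_derivative f (at x) v = frechet_derivative g (at x) v" if "x \<in> W" for x
      using frechet_derivative_transform_within_open[OF diff[OF that] \<open>open W\<close> that Suc.prems(1)]
      by simp
  qed
  ultimately show ?case by simp
qed

lemma Ck_on_SucI:
  assumes "open W" "\<And>x. x \<in> W \<Longrightarrow> (f has_derivative f' x) (at x)"
    and "\<And>v. Ck_on k W (\<lambda>x. f' x v)"
  shows "Ck_on (Suc k) W f"
proof -
  have "Ck_on k W (\<lambda>x. frechet_derivative f (at x) v)" for v
    using assms(1) _ assms(3)[of v]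
    by (rule Ck_on_cong) (simp add: frechet_derivative_at[OF assms(2), symmetric])
  then show ?thesis
    using assms(2) by (auto simp: differentiable_def)
qed

lemma Ck_on_SucD:
  assumes "Ck_on (Suc k) W f"
  shows "x \<in> W \<Longrightarrow> (f has_derivative frechet_derivative f (at x)) (at x)"
    and "Ck_on k W (\<lambda>x. frechet_derivative f (at x) v)"
  using assms by (auto simp: frechet_derivative_works[symmetric])

lemma Ck_on_Suc_imp: "Ck_on (Suc k) W f \<Longrightarrow> Ck_on k W f"
proof (induction k arbitrary: f)
  case 0
  then show ?case
    by (auto intro!: continuous_at_imp_continuous_on differentiable_imp_continuous_within)
next
  case (Suc k)
  then show ?case
    by (metis Ck_on.simps(2))
qed

lemma Ck_on_imp_continuous_on: "Ck_on k W f \<Longrightarrow> continuous_on W f"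
  by (induction k) (simp, metis Ck_on_Suc_imp)

lemma Ck_on_const [intro, simp]: "Ck_on k W (\<lambda>x. c)"
  by (induction k arbitrary: c) auto

lemma Ck_on_bounded_linear:
  assumes "bounded_linear L" "open W"
  shows "Ck_on k W L"
proof (cases k)
  case 0
  then show ?thesis
    using bounded_linear.continuous_on[OF assms(1) continuous_on_id] by simp
next
  case (Suc m)
  show ?thesis
    unfolding Suc using assms(2) bounded_linear.has_derivative[OF assms(1) has_derivative_ident]
    by (rule Ck_on_SucI) auto
qed

lemma Ck_on_add:
  assumes "open W" "Ck_on k W f" "Ck_on k W g"
  shows "Ck_on k W (\<lambda>x. f x + g x)"
  using assms(2,3)
proof (induction k arbitrary: f g)
  case 0
  then show ?case by (auto intro: continuous_on_add)
next
  case (Suc k)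
  show ?case
    using assms(1) has_derivative_add[OF Ck_on_SucD(1)[OF Suc.prems(1)] Ck_on_SucD(1)[OF Suc.prems(2)]]
  proof (rule Ck_on_SucI)
    fix v
    show "Ck_on k W (\<lambda>x. frechet_derivative f (at x) v + frechet_derivative g (at x) v)"
      by (rule Suc.IH; rule Ck_on_SucD(2); fact)
  qed auto
qed

lemma Ck_on_sum:
  assumes "open W" "\<And>i. i \<in> I \<Longrightarrow> Ck_on k W (f i)"
  shows "Ck_on k W (\<lambda>x. \<Sum>i\<in>I. f i x)"
  using assms(2)
  by (induction I rule: infinite_finite_induct) (auto intro: Ck_on_add[OF assms(1)])

text \<open>The product rule expresses a derivative of \<open>B f g\<close> by terms of the same shape with one factor
  replaced by its derivative; the other factor only needs to be one order less smooth. All products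
  below are instances.\<close>

lemma Ck_on_bilinear:
  assumes "bounded_bilinear B" "open W" "Ck_on k W f" "Ck_on k W g"
  shows "Ck_on k W (\<lambda>x. B (f x) (g x))"
  using assms(3,4)
proof (induction k arbitrary: f g)
  case 0
  then show ?case by (auto intro: bounded_bilinear.continuous_on[OF assms(1)])
next
  case (Suc k)
  show ?case
    using assms(2)
      bounded_bilinear.FDERIV[OF assms(1) Ck_on_SucD(1)[OF Suc.prems(1)] Ck_on_SucD(1)[OF Suc.prems(2)]]
  proof (rule Ck_on_SucI)
    fix v
    show "Ck_on k W (\<lambda>x. B (f x) (frechet_derivative g (at x) v)
                          + B (frechet_derivative f (at x) v) (g x))"
      by (intro Ck_on_add[OF assms(2)] Suc.IH Suc.prems[THEN Ck_on_SucD(2)] Suc.prems[THEN Ck_on_Suc_imp])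
  qed auto
qed

lemmas Ck_on_scaleR = Ck_on_bilinear[OF bounded_bilinear_scaleR]
lemmas Ck_on_mult = Ck_on_bilinear[OF bounded_bilinear_mult]

lemma Ck_on_diff:
  assumes "open W" "Ck_on k W f" "Ck_on k W g"
  shows "Ck_on k W (\<lambda>x. f x - g x)"
  using Ck_on_add[OF assms(1,2) Ck_on_scaleR[OF assms(1) Ck_on_const[of k W "-1"] assms(3)]] by simp

lemma Ck_on_prod:
  fixes f :: "'i \<Rightarrow> 'a::euclidean_space \<Rightarrow> real"
  assumes "open W" "\<And>i. i \<in> I \<Longrightarrow> Ck_on k W (f i)"
  shows "Ck_on k W (\<lambda>x. \<Prod>i\<in>I. f i x)"
  using assms(2)
  by (induction I rule: infinite_finite_induct) (auto intro: Ck_on_mult[OF assms(1)])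

text \<open>The chain rule \<open>D(g \<circ> f)(x) v = Dg(f x)(Df(x) v)\<close> is not directly of a form to which the
  induction hypothesis applies, since the direction \<open>Df(x) v\<close> varies with \<open>x\<close>. Expanding it in a
  basis leaves only compositions with the fixed-direction derivatives of \<open>g\<close>, and products.\<close>

lemma Ck_on_compose:
  fixes f :: "'a::euclidean_space \<Rightarrow> 'c::euclidean_space"
    and g :: "'c \<Rightarrow> 'b::real_normed_vector"
  assumes "open W" "open V" "Ck_on k W f" "Ck_on k V g" "f ` W \<subseteq> V"
  shows "Ck_on k W (\<lambda>x. g (f x))"
  using assms(3,4)
proof (induction k arbitrary: g)
  case 0
  then show ?case using assms(5) by (auto intro: continuous_on_compose2)
next
  case (Suc k)
  let ?f' = "\<lambda>x. frechet_derivative f (at x)" and ?g' = "\<lambda>x. frechet_derivative g (at x)"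
  show ?case
    using assms(1)
  proof (rule Ck_on_SucI)
    fix x assume x: "x \<in> W"
    then have f: "(f has_derivative ?f' x) (at x)" and g: "(g has_derivative ?g' (f x)) (at (f x))"
      using Ck_on_SucD(1)[OF Suc.prems(1)] Ck_on_SucD(1)[OF Suc.prems(2)] assms(5) by auto
    have "linear (?g' (f x))"
      using g has_derivative_linear by blast
    then have expand: "?g' (f x) w = (\<Sum>b\<in>Basis. (w \<bullet> b) *\<^sub>R ?g' (f x) b)" for w
      using linear_sum[of "?g' (f x)" "\<lambda>b. (w \<bullet> b) *\<^sub>R b" Basis]
      by (simp add: euclidean_representation linear_cmul)
    show "((\<lambda>x. g (f x)) has_derivative (\<lambda>v. \<Sum>b\<in>Basis. (?f' x v \<bullet> b) *\<^sub>R ?g' (f x) b)) (at x)"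
      using has_derivative_compose[OF f g] by (subst expand[symmetric])
  next
    fix v
    show "Ck_on k W (\<lambda>x. \<Sum>b\<in>Basis. (?f' x v \<bullet> b) *\<^sub>R ?g' (f x) b)"
      by (intro Ck_on_sum[OF assms(1)] Ck_on_scaleR[OF assms(1)] Suc.IH Ck_on_SucD(2)[OF Suc.prems(2)]
          Ck_on_bilinear[OF bounded_bilinear_inner assms(1)] Ck_on_const Ck_on_SucD(2)[OF Suc.prems(1)]
          Ck_on_Suc_imp[OF Suc.prems(1)])
  qed
qed

lemma Ck_on_linear_compose:
  fixes f :: "'a::euclidean_space \<Rightarrow> 'c::euclidean_space"
  assumes "linear L" "open W" "Ck_on k W f"
  shows "Ck_on k W (\<lambda>x. L (f x))"
  by (rule Ck_on_compose[OF assms(2) open_UNIV assms(3)])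
    (auto intro!: Ck_on_bounded_linear simp: assms(1) linear_conv_bounded_linear[symmetric])

lemma Ck_on_inverse:
  fixes f :: "'a::euclidean_space \<Rightarrow> real"
  assumes "open W" "Ck_on k W f" "\<And>x. x \<in> W \<Longrightarrow> f x \<noteq> 0"
  shows "Ck_on k W (\<lambda>x. inverse (f x))"
  using assms(2)
proof (induction k)
  case 0
  then show ?case using assms(3) by (auto intro: continuous_on_inverse)
next
  case (Suc k)
  let ?f' = "\<lambda>x. frechet_derivative f (at x)"
  show ?case
    using assms(1) Deriv.has_derivative_inverse[OF assms(3) Ck_on_SucD(1)[OF Suc.prems]]
  proof (rule Ck_on_SucI)
    fix v
    have "Ck_on k W (\<lambda>x. (-1) * (inverse (f x) * ?f' x v * inverse (f x)))"
      by (intro Ck_on_mult[OF assms(1)] Ck_on_const Suc.IH Ck_on_SucD(2)[OF Suc.prems]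
          Ck_on_Suc_imp[OF Suc.prems])
    then show "Ck_on k W (\<lambda>x. - (inverse (f x) * ?f' x v * inverse (f x)))"
      by simp
  qed auto
qed

lemma Ck_on_divide:
  fixes f g :: "'a::euclidean_space \<Rightarrow> real"
  assumes "open W" "Ck_on k W f" "Ck_on k W g" "\<And>x. x \<in> W \<Longrightarrow> g x \<noteq> 0"
  shows "Ck_on k W (\<lambda>x. f x / g x)"
  unfolding divide_inverse by (intro Ck_on_mult Ck_on_inverse assms)

lemma Ck_on_vec_lambda:
  fixes f :: "'a::euclidean_space \<Rightarrow> 'i::finite \<Rightarrow> 'b::euclidean_space"
  assumes "open W" "\<And>i. Ck_on k W (\<lambda>x. f x i)"
  shows "Ck_on k W (\<lambda>x. \<chi> i. f x i)"
proof -
  have "(\<lambda>x. \<chi> i. f x i) = (\<lambda>x. \<Sum>i\<in>UNIV. axis i (f x i))"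
    by (auto simp: fun_eq_iff vec_eq_iff axis_def)
  moreover have "linear (axis i :: 'b \<Rightarrow> 'b^'i)" for i
    by (auto intro!: linearI simp: vec_eq_iff axis_def)
  ultimately show ?thesis
    by (simp only:) (intro Ck_on_sum assms Ck_on_linear_compose[where L = "axis i" for i])
qed

lemma Ck_on_vec_nth:
  fixes f :: "'a::euclidean_space \<Rightarrow> 'b::euclidean_space^'i"
  assumes "open W" "Ck_on k W f"
  shows "Ck_on k W (\<lambda>x. f x $ i)"
  by (rule Ck_on_linear_compose[OF _ assms]) (auto intro!: linearI)

section \<open>The smooth inverse of an injective map with invertible derivatives\<close>

text \<open>By Cramer's rule the solution is a rational function of the coefficients.\<close>

lemma Ck_on_linear_solve:
  fixes A :: "'a::euclidean_space \<Rightarrow> real^'n^'n"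
  assumes "open W" "Ck_on k W A" "Ck_on k W b"
    and "\<And>x. x \<in> W \<Longrightarrow> det (A x) \<noteq> 0"
    and "\<And>x. x \<in> W \<Longrightarrow> A x *v w x = b x"
  shows "Ck_on k W w"
proof -
  have det: "Ck_on k W (\<lambda>x. det (B x))" if "\<And>i j. Ck_on k W (\<lambda>x. B x $ i $ j)"
    for B :: "'a \<Rightarrow> real^'n^'n"
    unfolding det_def
    by (intro Ck_on_sum[OF assms(1)] Ck_on_mult[OF assms(1)] Ck_on_const Ck_on_prod[OF assms(1)] that)
  have entry: "Ck_on k W (\<lambda>x. A x $ i $ j)" "Ck_on k W (\<lambda>x. b x $ i)" for i j
    by (intro Ck_on_vec_nth assms)+
  have "Ck_on k W (\<lambda>x. \<chi> l. det (\<chi> i j. if j = l then b x $ i else A x $ i $ j) / det (A x))"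
    using entry by (intro Ck_on_vec_lambda Ck_on_divide det assms) (rename_tac l i j, case_tac "j = l", auto)
  then show ?thesis
    using assms(1)
  proof (rule Ck_on_cong[rotated 2])
    fix x assume "x \<in> W"
    then show "(\<chi> l. det (\<chi> i j. if j = l then b x $ i else A x $ i $ j) / det (A x)) = w x"
      using cramer[of "A x" "w x" "b x"] assms(4,5) by simp
  qed
qed

text \<open>Invariance of domain replaces the local inverse function theorem here: for an injective map it
  yields at once that the image is open and the inverse continuous. The derivative of the inverse at \<open>y\<close>
  in direction \<open>v\<close> solves the linear system with matrix \<open>Df(f\<^sup>-\<^sup>1 y)\<close> and right-hand side \<open>v\<close>. Hence
  it is of class \<open>C\<^sup>k\<close> as soon as the inverse is, and the order of smoothness climbs by induction.\<close>

theorem smooth_inverse: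
  fixes f :: "real^'n \<Rightarrow> real^'n"
  assumes "open S" and inj: "inj_on f S" and Ck: "\<And>k. Ck_on k S f"
    and deriv: "\<And>x. x \<in> S \<Longrightarrow> (f has_derivative f' x) (at x)"
    and nz: "\<And>x v. x \<in> S \<Longrightarrow> f' x v = 0 \<Longrightarrow> v = 0"
  shows "open (f ` S)" and "Ck_on k (f ` S) (inv_into S f)"
proof -
  let ?g = "inv_into S f"
  have cont: "continuous_on S f"
    using Ck[of 0] by simp
  show op: "open (f ` S)"
    using invariance_of_domain cont \<open>open S\<close> inj by blast
  have contg: "continuous_on (f ` S) ?g"
    using continuous_on_inverse_open[OF \<open>open S\<close> cont] inj by simp
  have lin: "linear (f' x)" if "x \<in> S" for x
    using deriv[OF that] has_derivative_linear by blast
  have det: "det (matrix (f' x)) \<noteq> 0" if "x \<in> S" for x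
    using lin[OF that] nz[OF that] by (simp add: det_nz_iff_inj linear_injective_0)
  have "\<exists>G. bounded_linear G \<and> G \<circ> f' x = id \<and> f' x \<circ> G = id" if "x \<in> S" for x
    using linear_injective_isomorphism[OF lin[OF that]] nz[OF that] lin[OF that]
    by (auto simp: linear_injective_0 linear_conv_bounded_linear fun_eq_iff)
  then obtain G where G: "\<And>x. x \<in> S \<Longrightarrow> bounded_linear (G x) \<and> G x \<circ> f' x = id \<and> f' x \<circ> G x = id"
    by metis
  have derivg: "(?g has_derivative G (?g y)) (at y)" if y: "y \<in> f ` S" for y
  proof (rule has_derivative_inverse_basic[OF deriv _ _ _ op y])
    show "?g y \<in> S" using y by (rule inv_into_into)
    then show "bounded_linear (G (?g y))" "G (?g y) \<circ> f' (?g y) = id"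
      using G by auto
    show "continuous (at y) ?g"
      using contg op y continuous_on_eq_continuous_at by blast
  qed (auto intro: f_inv_into_f)
  show "Ck_on k (f ` S) ?g"
  proof (induction k)
    case 0
    then show ?case using contg by simp
  next
    case (Suc k)
    show ?case
    proof (rule Ck_on_SucI[OF op derivg])
      fix v
      have "Ck_on k S (\<lambda>x. f' x w)" for w
        using \<open>open S\<close> _ Ck_on_SucD(2)[OF Ck[of "Suc k"], of w]
        by (rule Ck_on_cong) (simp add: frechet_derivative_at[OF deriv, symmetric])
      then have "Ck_on k S (\<lambda>x. matrix (f' x))"
        unfolding matrix_def by (intro Ck_on_vec_lambda Ck_on_vec_nth \<open>open S\<close>)
      then have mat: "Ck_on k (f ` S) (\<lambda>y. matrix (f' (?g y)))"
        by (rule Ck_on_compose[OF op \<open>open S\<close> Suc.IH]) (auto intro: inv_into_into)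
      show "Ck_on k (f ` S) (\<lambda>y. G (?g y) v)"
      proof (rule Ck_on_linear_solve[OF op mat Ck_on_const])
        fix y assume "y \<in> f ` S"
        then have g: "?g y \<in> S" by (rule inv_into_into)
        show "det (matrix (f' (?g y))) \<noteq> 0" by (rule det[OF g])
        show "matrix (f' (?g y)) *v G (?g y) v = v"
          using G[OF g] lin[OF g] by (simp add: matrix_works fun_eq_iff)
      qed
    qed
  qed
qed

section \<open>Images of smooth sections\<close>

lemma smooth_onI:
  assumes "open W" "A \<subseteq> W" "\<And>k. Ck_on k W g" "\<And>x. x \<in> A \<Longrightarrow> g x = f x"
  shows "smooth_on A f"
  unfolding smooth_on_def using assms by blast

text \<open>Let \<open>s\<close> be a section of the linear projection \<open>\<pi>\<close> over an open set \<open>H\<close>, and \<open>\<iota>\<close> a linear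
  section. Then \<open>G = s - \<iota>\<close> takes values in the kernel of \<open>\<pi>\<close>, so the shear
  \<open>A \<mapsto> A - G(\<pi> A)\<close> preserves \<open>\<pi>\<close> and has the inverse \<open>A \<mapsto> A + G(\<pi> A)\<close>. It moves \<open>s h\<close> to \<open>\<iota> h\<close>,
  and thus straightens the image of \<open>s\<close> to a piece of the linear space \<open>range \<iota>\<close>. The same chart
  serves at every point.\<close>

theorem embedded_submanifold_section:
  fixes \<pi> :: "'a::euclidean_space \<Rightarrow> 'b::euclidean_space"
  assumes E: "subspace E" "openin (top_of_set E) P"
    and \<pi>: "linear \<pi>"
    and \<iota>: "linear \<iota>" "\<And>h. \<iota> h \<in> E" "\<And>h. \<pi> (\<iota> h) = h"
    and "open H" and s: "\<And>k. Ck_on k H s" "\<And>h. h \<in> H \<Longrightarrow> s h \<in> P" "\<And>h. h \<in> H \<Longrightarrow> \<pi> (s h) = h"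
  shows "embedded_submanifold DIM('b) E P (s ` H)"
proof -
  define Q where "Q = \<pi> -` H"
  define G where "G h = s h - \<iota> h" for h
  define \<phi> where "\<phi> A = A - G (\<pi> A)" for A
  define \<kappa> where "\<kappa> A = A + G (\<pi> A)" for A
  have "open Q"
    unfolding Q_def using \<pi> by (intro open_vimage \<open>open H\<close> linear_continuous_on) (simp add: linear_linear)
  have "P \<subseteq> E"
    using openin_imp_subset[OF E(2)] .
  have \<pi>G: "\<pi> (G h) = 0" if "h \<in> H" for h
    using s(3)[OF that] \<iota>(3) \<pi> by (simp add: G_def linear_diff)
  have GE: "G h \<in> E" if "h \<in> H" for h
    unfolding G_def using E(1) s(2)[OF that] \<iota>(2) \<open>P \<subseteq> E\<close> by (blast intro: subspace_diff)
  have \<pi>\<phi>: "\<pi> (\<phi> A) = \<pi> A" "\<pi> (\<kappa> A) = \<pi> A" if "A \<in> Q" for A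
    using that \<pi>G \<pi> by (auto simp: Q_def \<phi>_def \<kappa>_def linear_diff linear_add)
  have inverse: "\<kappa> (\<phi> A) = A" "\<phi> (\<kappa> A) = A" if "A \<in> Q" for A
    using \<pi>\<phi>[OF that] by (simp_all add: \<phi>_def \<kappa>_def)
  have \<pi>k: "Ck_on k Q \<pi>" for k
    using \<pi> \<open>open Q\<close> by (intro Ck_on_bounded_linear) (simp_all add: linear_linear)
  have "Ck_on k H G" for k
    unfolding G_def using \<iota>(1) \<open>open H\<close>
    by (intro Ck_on_diff s(1) Ck_on_bounded_linear) (simp_all add: linear_linear)
  then have Gk: "Ck_on k Q (\<lambda>A. G (\<pi> A))" for k
    by (intro Ck_on_compose[OF \<open>open Q\<close> \<open>open H\<close> \<pi>k]) (auto simp: Q_def)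
  have idk: "Ck_on k Q (\<lambda>A. A)" for k
    using \<open>open Q\<close> by (intro Ck_on_bounded_linear bounded_linear_ident)
  have \<phi>k: "Ck_on k Q \<phi>" and \<kappa>k: "Ck_on k Q \<kappa>" for k
    unfolding \<phi>_def \<kappa>_def by (intro Ck_on_diff Ck_on_add idk Gk \<open>open Q\<close>)+
  obtain V where V: "open V" "P = E \<inter> V"
    using E(2) by (auto simp: openin_open)
  define U where "U = P \<inter> Q"
  have "U \<subseteq> E" using \<open>P \<subseteq> E\<close> by (auto simp: U_def)
  have \<phi>U: "\<phi> ` U = E \<inter> (Q \<inter> \<kappa> -` V)"
  proof (intro set_eqI iffI)
    fix B assume "B \<in> \<phi> ` U"
    then obtain A where A: "A \<in> U" "B = \<phi> A" by auto
    then have "A \<in> Q" by (auto simp: U_def)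
    then have "B \<in> Q" "\<kappa> B = A"
      using \<pi>\<phi>(1)[of A] inverse(1) A(2) by (auto simp: Q_def)
    moreover have "B \<in> E"
      unfolding A(2) \<phi>_def using GE[of "\<pi> A"] \<open>A \<in> Q\<close> A(1) \<open>U \<subseteq> E\<close> E(1)
      by (auto simp: Q_def intro: subspace_diff)
    ultimately show "B \<in> E \<inter> (Q \<inter> \<kappa> -` V)"
      using A(1) V by (auto simp: U_def)
  next
    fix B assume B: "B \<in> E \<inter> (Q \<inter> \<kappa> -` V)"
    then have "\<kappa> B \<in> E"
      unfolding \<kappa>_def using GE[of "\<pi> B"] E(1) by (auto simp: Q_def intro: subspace_add)
    moreover have "\<kappa> B \<in> Q"
      using B \<pi>\<phi>(2)[of B] by (auto simp: Q_def)
    ultimately have "\<kappa> B \<in> U"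
      using B V by (auto simp: U_def)
    then show "B \<in> \<phi> ` U"
      using inverse(2)[of B] B by (metis IntD1 IntD2 image_eqI)
  qed
  have openU: "openin (top_of_set E) U"
    unfolding U_def using E(2) \<open>open Q\<close> by (metis Int_commute openin_Int_open)
  have "open (Q \<inter> \<kappa> -` V)"
    using Ck_on_imp_continuous_on[OF \<kappa>k] \<open>open Q\<close> V(1) by (rule continuous_open_preimage)
  then have openW: "openin (top_of_set E) (\<phi> ` U)"
    unfolding \<phi>U by (rule openin_open_Int)
  have inj: "inj_on \<phi> U"
    using inverse(1) by (intro inj_on_inverseI[of _ \<kappa>]) (auto simp: U_def)
  have "smooth_on (\<phi> ` U) (inv_into U \<phi>)"
  proof (rule smooth_onI[OF \<open>open Q\<close> _ \<kappa>k])
    show "\<phi> ` U \<subseteq> Q" using \<phi>U by auto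
    fix B assume "B \<in> \<phi> ` U"
    then show "\<kappa> B = inv_into U \<phi> B"
      using inverse(1) inj by (auto simp: U_def)
  qed
  moreover have "smooth_on U \<phi>"
    by (rule smooth_onI[OF \<open>open Q\<close> _ \<phi>k]) (auto simp: U_def)
  ultimately have diffeo: "diffeo_on U (\<phi> ` U) \<phi>"
    using inj by (auto simp: diffeo_on_def bij_betw_def)
  have sU: "s ` H \<subseteq> U"
    using s by (auto simp: U_def Q_def)
  have slice: "\<phi> ` (U \<inter> s ` H) = \<phi> ` U \<inter> range \<iota>"
  proof (intro set_eqI iffI)
    fix B assume "B \<in> \<phi> ` (U \<inter> s ` H)"
    then obtain h where h: "h \<in> H" "B = \<phi> (s h)" "s h \<in> U" by auto
    then have "B = \<iota> h"
      using s(3) by (simp add: \<phi>_def G_def)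
    then show "B \<in> \<phi> ` U \<inter> range \<iota>" using h by blast
  next
    fix B assume "B \<in> \<phi> ` U \<inter> range \<iota>"
    then obtain A h where A: "A \<in> U" "B = \<phi> A" "B = \<iota> h" by auto
    then have "A \<in> Q" by (auto simp: U_def)
    then have h: "\<pi> A = h"
      using \<pi>\<phi>(1)[of A] A \<iota>(3) by metis
    then have "A = s h"
      using A(2,3) by (simp add: \<phi>_def G_def)
    then show "B \<in> \<phi> ` (U \<inter> s ` H)"
      using A h \<open>A \<in> Q\<close> by (auto simp: Q_def)
  qed
  have "inj \<iota>"
    using \<iota>(3) by (metis injI)
  then have "dim (range \<iota>) = DIM('b)"
    using dim_image_eq[OF \<iota>(1), of UNIV] by (simp add: inj_on_subset)
  moreover have "subspace (range \<iota>)" "range \<iota> \<subseteq> E"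
    using \<iota>(1,2) by (auto intro: linear_subspace_image)
  ultimately have chart: "U \<subseteq> P \<and> openin (top_of_set E) U \<and> openin (top_of_set E) (\<phi> ` U) \<and>
      diffeo_on U (\<phi> ` U) \<phi> \<and> subspace (range \<iota>) \<and> range \<iota> \<subseteq> E \<and> dim (range \<iota>) = DIM('b) \<and>
      \<phi> ` (U \<inter> s ` H) = \<phi> ` U \<inter> range \<iota>"
    using openU openW diffeo slice by (simp add: U_def)
  show ?thesis
    unfolding embedded_submanifold_def
  proof (intro conjI ballI)
    show "s ` H \<subseteq> P" using sU by (auto simp: U_def)
    fix x assume "x \<in> s ` H"
    then have x: "x \<in> U" using sU by blast
    show "\<exists>U W \<phi> L. x \<in> U \<and> U \<subseteq> P \<and> openin (top_of_set E) U \<and> openin (top_of_set E) W \<and>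
        diffeo_on U W \<phi> \<and> subspace L \<and> L \<subseteq> E \<and> dim L = DIM('b) \<and> \<phi> ` (U \<inter> s ` H) = W \<inter> L"
      by (rule exI[of _ U], rule exI[of _ "\<phi> ` U"], rule exI[of _ \<phi>], rule exI[of _ "range \<iota>"])
        (rule conjI[OF x chart])
  qed
qed

section \<open>Symmetric and positive definite matrices\<close>

lemma subspace_sym_mat: "subspace (sym_mat :: (real^'n^'n) set)"
  by (auto simp: subspace_def sym_mat_def transpose_def vec_eq_iff)

text \<open>The quadratic form of a positive definite matrix has a positive minimum \<open>m\<close> on the compact unit
  sphere, and a perturbation of norm below \<open>m / K\<close> changes the form there by less than \<open>m\<close>.\<close>

lemma openin_spd: "openin (top_of_set sym_mat) (spd :: (real^'n^'n) set)"
proof -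
  let ?q = "\<lambda>(A::real^'n^'n) x. x \<bullet> (A *v x)"
  define B :: "real^'n^'n \<Rightarrow> real^'n \<Rightarrow> real^'n" where "B = (\<lambda>A x. A *v x)"
  have "bilinear B"
    unfolding bilinear_def B_def
    by (auto intro!: linearI simp: matrix_vector_mult_add_rdistrib matrix_vector_right_distrib
        scaleR_matrix_vector_assoc matrix_vector_mult_scaleR)
  then have "bounded_bilinear B"
    by (simp add: bilinear_conv_bounded_bilinear)
  from bounded_bilinear.pos_bounded[OF this]
  obtain K where K: "K > 0" and K': "\<forall>A x. norm (B A x) \<le> norm A * norm x * K"
    by auto
  have "\<exists>e>0. \<forall>A'. dist A' A < e \<longrightarrow> A' \<in> sym_mat \<longrightarrow> A' \<in> spd" if A: "A \<in> spd" for A :: "real^'n^'n"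
  proof -
    have "continuous_on (sphere 0 1) (?q A)"
      by (intro continuous_intros linear_continuous_on matrix_vector_mul_bounded_linear)
    moreover have "sphere 0 1 \<noteq> ({} :: (real^'n) set)" by simp
    ultimately have "\<exists>x0\<in>sphere 0 1. \<forall>y\<in>sphere 0 1. ?q A x0 \<le> ?q A y"
      by (intro continuous_attains_inf compact_sphere)
    then obtain x0 where x0: "x0 \<in> sphere 0 1" "\<forall>y\<in>sphere 0 1. ?q A x0 \<le> ?q A y"
      by blast
    define m where "m = ?q A x0"
    have "x0 \<noteq> 0" using x0(1) by auto
    then have "m > 0"
      using A by (simp add: spd_def m_def)
    have "A' \<in> spd" if A': "dist A' A < m / K" "A' \<in> sym_mat" for A'
    proof -
      have "?q A' x > 0" if "x \<noteq> 0" for x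
      proof -
        define y where "y = x /\<^sub>R norm x"
        have y: "norm y = 1" "x = norm x *\<^sub>R y"
          using that by (auto simp: y_def)
        have "\<bar>?q (A - A') y\<bar> \<le> norm (A - A') * K"
          using Cauchy_Schwarz_ineq2[of y "(A - A') *v y"] K'[rule_format, of "A - A'" y] y(1)
          by (simp add: B_def)
        also have "\<dots> < m"
          using A'(1) K by (simp add: dist_norm norm_minus_commute field_simps)
        finally have "?q A y - ?q A' y < m"
          by (simp add: matrix_vector_mult_diff_rdistrib inner_diff_right)
        moreover have "m \<le> ?q A y"
          using x0(2) y(1) by (simp add: m_def)
        ultimately have "?q A' y > 0" by linarith
        moreover have "?q A' x = (norm x)\<^sup>2 * ?q A' y"
          by (subst (1 2) y(2)) (simp add: matrix_vector_mult_scaleR power2_eq_square)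
        ultimately show ?thesis using that by simp
      qed
      then show ?thesis using A'(2) by (simp add: spd_def)
    qed
    then show ?thesis
      using \<open>m > 0\<close> K by (intro exI[of _ "m / K"]) auto
  qed
  moreover have "spd \<subseteq> (sym_mat :: (real^'n^'n) set)" by (auto simp: spd_def)
  ultimately show ?thesis
    unfolding openin_euclidean_subtopology_iff by blast
qed

text \<open>The entries \<open>(Some j, None)\<close> of the moment matrix are the means of the \<open>u j\<close>, since \<open>None\<close>
  indexes the constant coordinate. The matrices \<open>bordered h\<close> span a complement of the kernel of
  \<open>last_column\<close> in the symmetric matrices.\<close>

definition last_column :: "real^('d option)^('d option) \<Rightarrow> real^'d::finite" where
  "last_column A = (\<chi> j. A $ Some j $ None)"

definition bordered :: "real^'d::finite \<Rightarrow> real^('d option)^('d option)" where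
  "bordered h = (\<chi> i j. case i of
     Some k \<Rightarrow> (case j of Some l \<Rightarrow> 0 | None \<Rightarrow> h $ k)
   | None \<Rightarrow> (case j of Some l \<Rightarrow> h $ l | None \<Rightarrow> 0))"

lemma linear_last_column: "linear last_column"
  by (auto intro!: linearI simp: last_column_def vec_eq_iff)

lemma linear_bordered: "linear bordered"
  by (auto intro!: linearI simp: bordered_def vec_eq_iff split: option.split)

lemma bordered_sym: "bordered h \<in> sym_mat"
  by (auto simp: bordered_def sym_mat_def transpose_def vec_eq_iff split: option.split)

lemma last_column_bordered: "last_column (bordered h) = h"
  by (simp add: last_column_def bordered_def vec_eq_iff)

lemma sum_option:
  fixes f :: "'d::finite option \<Rightarrow> real"
  shows "(\<Sum>i\<in>UNIV. f i) = f None + (\<Sum>j\<in>UNIV. f (Some j))"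
  by (simp add: UNIV_option_conv sum.reindex)

section \<open>Estimates for the hyperbolic cosine and the exponential\<close>

lemma cosh_mono_abs: "\<bar>x\<bar> \<le> \<bar>y\<bar> \<Longrightarrow> cosh x \<le> cosh (y::real)"
  by (metis abs_ge_zero cosh_real_abs cosh_real_nonneg_le_iff)

lemma cosh_convex_comb:
  assumes "0 \<le> t" "t \<le> (1::real)"
  shows "cosh ((1 - t) * x + t * y) \<le> (1 - t) * cosh x + t * cosh y"
proof -
  have "exp ((1 - t) * x + t * y) \<le> (1 - t) * exp x + t * exp y"
    and "exp ((1 - t) * (- x) + t * (- y)) \<le> (1 - t) * exp (- x) + t * exp (- y)"
    using convex_onD[OF exp_convex assms, of x y] convex_onD[OF exp_convex assms, of "- x" "- y"]
    by (simp_all only: real_scaleR_def UNIV_I)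
  moreover have "- ((1 - t) * x + t * y) = (1 - t) * (- x) + t * (- y)"
    by (simp add: algebra_simps)
  moreover have "(1 - t) * ((a + b) / 2) + t * ((c + d) / 2)
      = (((1 - t) * a + t * c) + ((1 - t) * b + t * d)) / 2" for a b c d
    by (simp add: field_simps)
  ultimately show ?thesis
    unfolding cosh_field_def by simp
qed

lemma abs_le_two_cosh: "\<bar>x\<bar> \<le> 2 * cosh (x::real)"
proof -
  have "\<bar>x\<bar> \<le> exp \<bar>x\<bar>"
    using exp_gt_self[of "\<bar>x\<bar>"] by simp
  also have "\<dots> \<le> exp x + exp (- x)"
    by (cases "x \<ge> 0") auto
  finally show ?thesis by (simp add: cosh_field_def)
qed

text \<open>Taylor's formula with Lagrange remainder; the crude factor \<open>exp |t|\<close> is harmless because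
  exponentials of small multiples of the \<open>u j\<close> remain integrable.\<close>

lemma exp_remainder_le: "\<bar>exp t - 1 - t\<bar> \<le> t\<^sup>2 * exp \<bar>t\<bar>" for t :: real
proof -
  obtain s where s: "\<bar>s\<bar> \<le> \<bar>t\<bar>" "exp t = (\<Sum>m<2. t ^ m / fact m) + exp s / fact 2 * t ^ 2"
    using Maclaurin_exp_le[of t 2] by blast
  then have "\<bar>exp t - 1 - t\<bar> = t\<^sup>2 * (exp s / 2)"
    by (simp add: numeral_2_eq_2)
  also have "\<dots> \<le> t\<^sup>2 * exp \<bar>t\<bar>"
  proof (rule mult_left_mono)
    have "exp s \<le> exp \<bar>t\<bar>" using s(1) by simp
    then show "exp s / 2 \<le> exp \<bar>t\<bar>" using exp_gt_zero[of s] by linarith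
  qed simp
  finally show ?thesis .
qed

lemma exp_diff_mult_diff_nonneg: "0 \<le> (exp b - exp a) * (b - a)" for a b :: real
  by (cases "a \<le> b") (auto intro: mult_nonneg_nonneg mult_nonpos_nonpos)

lemma cosh_measurable [measurable (raw)]:
  "f \<in> borel_measurable N \<Longrightarrow> (\<lambda>x. cosh (f x :: real)) \<in> borel_measurable N"
  by (rule measurable_compose[OF _ borel_measurable_continuous_onI]) (auto intro: continuous_intros)

section \<open>The exponential Orlicz class\<close>

text \<open>All integrals against \<open>p\<close> are turned into integrals for the probability measure
  \<open>P = p \<cdot> \<mu>\<close>.\<close>

locale reference_density =
  fixes M :: "'a measure" and p :: "'a \<Rightarrow> real"
  assumes density: "p \<in> densities M"
begin

abbreviation P :: "'a measure" where
  "P \<equiv> density M (\<lambda>x. ennreal (p x))"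

lemma p_measurable [measurable]: "p \<in> borel_measurable M"
  and p_pos: "AE x in M. 0 < p x"
  and p_integral: "has_bochner_integral M p 1"
  using density by (auto simp: densities_def)

lemma p_nonneg: "AE x in M. 0 \<le> p x"
  using p_pos by eventually_elim simp

lemma P_const: "integrable P (\<lambda>x. c)" "(\<integral>x. c \<partial>P) = (c::real)"
proof -
  have int: "integrable M p" "(\<integral>x. p x \<partial>M) = 1"
    using p_integral by (auto simp: has_bochner_integral_iff)
  have "integrable P (\<lambda>x. c) \<longleftrightarrow> integrable M (\<lambda>x. p x * c)"
    by (rule integrable_real_density[OF p_measurable p_nonneg]) simp
  then show "integrable P (\<lambda>x. c)"
    using integrable_mult_left[OF int(1), of c] by blast
  have "(\<integral>x. c \<partial>P) = (\<integral>x. p x * c \<partial>M)"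
    by (rule integral_real_density[OF p_measurable p_nonneg]) simp
  also have "\<dots> = c" using int by simp
  finally show "(\<integral>x. c \<partial>P) = (c::real)" .
qed

lemma AE_P_const: "AE x in P. c \<Longrightarrow> c"
proof (rule ccontr)
  assume "AE x in P. c" "\<not> c"
  then have "AE x in P. (1::real) = 0" by simp
  then have "(\<integral>x. (1::real) \<partial>P) = (\<integral>x. 0 \<partial>P)"
    by (intro integral_cong_AE) auto
  then show False
    unfolding P_const(2) by simp
qed

lemma mean_eq: "f \<in> borel_measurable M \<Longrightarrow> mean M p f = (\<integral>x. f x \<partial>P)"
  by (simp add: mean_def integral_real_density p_nonneg mult.commute)

lemma nn_mean_eq:
  assumes [measurable]: "f \<in> borel_measurable M" and "\<And>x. 0 \<le> f x"
  shows "nn_mean M p f = (\<integral>\<^sup>+x. ennreal (f x) \<partial>P)"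
proof -
  have "nn_mean M p f = (\<integral>\<^sup>+x. ennreal (p x) * ennreal (f x) \<partial>M)"
    unfolding nn_mean_def using p_nonneg
    by (intro nn_integral_cong_AE, eventually_elim) (simp add: assms(2) ennreal_mult mult.commute)
  then show ?thesis by (simp add: nn_integral_density)
qed

lemma nn_mean_finite_iff:
  assumes [measurable]: "f \<in> borel_measurable M" and "\<And>x. 0 \<le> f x"
  shows "nn_mean M p f < \<infinity> \<longleftrightarrow> integrable P f"
  using assms by (simp add: nn_mean_eq integrable_iff_bounded)

lemma nn_mean_eq_integral:
  assumes "integrable P f" and "\<And>x. 0 \<le> f x"
  shows "nn_mean M p f = ennreal (\<integral>x. f x \<partial>P)"
  using assms borel_measurable_integrable[OF assms(1)] by (simp add: nn_mean_eq nn_integral_eq_integral)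

lemma integrable_cosh_minus_one:
  assumes [measurable]: "f \<in> borel_measurable M"
  shows "integrable P (\<lambda>x. cosh (f x) - 1) \<longleftrightarrow> integrable P (\<lambda>x. cosh (f x) :: real)"
proof
  assume "integrable P (\<lambda>x. cosh (f x) - 1)"
  from Bochner_Integration.integrable_add[OF this P_const(1)[of 1]]
  show "integrable P (\<lambda>x. cosh (f x))" by simp
qed (use P_const(1) in auto)

text \<open>The exponential Orlicz class before centring. Unlike the subspace \<open>orlicz_space\<close> of centred
  functions it is closed under absolute values, so it contains the sum of the \<open>|u j|\<close>.\<close>

definition exp_class :: "('a \<Rightarrow> real) set" where
  "exp_class = {f \<in> borel_measurable M. \<exists>\<alpha>>0. integrable P (\<lambda>x. cosh (\<alpha> * f x))}"

lemma orlicz_space_iff: "f \<in> orlicz_space M p \<longleftrightarrow> f \<in> exp_class \<and> (\<integral>x. f x \<partial>P) = 0"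
proof (cases "f \<in> borel_measurable M")
  case True
  note [measurable] = True
  have "nn_mean M p (\<lambda>x. cosh (\<alpha> * f x) - 1) < \<infinity> \<longleftrightarrow> integrable P (\<lambda>x. cosh (\<alpha> * f x))" for \<alpha>
    by (subst nn_mean_finite_iff) (auto simp: cosh_real_ge_1 integrable_cosh_minus_one)
  then show ?thesis
    by (simp add: orlicz_space_def exp_class_def mean_eq True)
qed (simp add: orlicz_space_def exp_class_def)

lemma exp_class_measurable: "f \<in> exp_class \<Longrightarrow> f \<in> borel_measurable M"
  by (simp add: exp_class_def)

lemma integrable_cosh_le:
  assumes "integrable P h" "g \<in> borel_measurable M" "\<And>x. cosh (g x) \<le> (h x :: real)"
  shows "integrable P (\<lambda>x. cosh (g x))"
proof (rule Bochner_Integration.integrable_bound[OF assms(1)])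
  have "norm (cosh (g x)) \<le> norm (h x)" for x
    using assms(3)[of x] cosh_real_nonneg[of "g x"] by simp
  then show "AE x in P. norm (cosh (g x)) \<le> norm (h x)" by simp
qed (use assms(2) in simp)

lemma integrable_cosh_bound:
  assumes "integrable P (\<lambda>x. cosh (f x) :: real)" "g \<in> borel_measurable M" "\<And>x. \<bar>g x\<bar> \<le> \<bar>f x\<bar>"
  shows "integrable P (\<lambda>x. cosh (g x))"
  using assms by (intro integrable_cosh_le[OF assms(1)]) (auto intro: cosh_mono_abs)

lemma exp_class_integrable:
  assumes "f \<in> exp_class"
  shows "integrable P f"
proof -
  obtain \<alpha> where \<alpha>: "\<alpha> > 0" "integrable P (\<lambda>x. cosh (\<alpha> * f x))"
    using assms by (auto simp: exp_class_def)
  from \<alpha>(2) have "integrable P (\<lambda>x. 2 / \<alpha> * cosh (\<alpha> * f x))"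
    by (rule integrable_mult_right)
  then show ?thesis
  proof (rule Bochner_Integration.integrable_bound)
    show "AE x in P. norm (f x) \<le> norm (2 / \<alpha> * cosh (\<alpha> * f x))"
      using abs_le_two_cosh[of "\<alpha> * f x" for x] \<alpha>(1) by (auto simp: abs_mult field_simps)
  qed (use exp_class_measurable[OF assms] in simp)
qed

text \<open>Halving the exponent pays for the sum, by convexity of the hyperbolic cosine.\<close>

lemma exp_class_add:
  assumes f: "f \<in> exp_class" and g: "g \<in> exp_class"
  shows "(\<lambda>x. f x + g x) \<in> exp_class"
proof -
  note [measurable] = exp_class_measurable[OF f] exp_class_measurable[OF g]
  obtain \<alpha> \<beta> where ab: "\<alpha> > 0" "integrable P (\<lambda>x. cosh (\<alpha> * f x))"
      "\<beta> > 0" "integrable P (\<lambda>x. cosh (\<beta> * g x))"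
    using f g by (auto simp: exp_class_def)
  \<comment> \<open>An exponent that works for both summands; half of it works for the sum.\<close>
  define \<gamma> where "\<gamma> = min \<alpha> \<beta>"
  have "\<gamma> > 0" "\<gamma> \<le> \<alpha>" "\<gamma> \<le> \<beta>" using ab by (auto simp: \<gamma>_def)
  have "integrable P (\<lambda>x. cosh (\<gamma> * f x))"
    using \<open>\<gamma> > 0\<close> \<open>\<gamma> \<le> \<alpha>\<close> by (intro integrable_cosh_bound[OF ab(2)]) (auto simp: abs_mult mult_right_mono)
  moreover have "integrable P (\<lambda>x. cosh (\<gamma> * g x))"
    using \<open>\<gamma> > 0\<close> \<open>\<gamma> \<le> \<beta>\<close> by (intro integrable_cosh_bound[OF ab(4)]) (auto simp: abs_mult mult_right_mono)
  ultimately have "integrable P (\<lambda>x. cosh (\<gamma> * f x) + cosh (\<gamma> * g x))"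
    by (rule Bochner_Integration.integrable_add)
  then have "integrable P (\<lambda>x. cosh (\<gamma> / 2 * (f x + g x)))"
  proof (rule integrable_cosh_le)
    fix x
    have "cosh (\<gamma> / 2 * (f x + g x)) \<le> (cosh (\<gamma> * f x) + cosh (\<gamma> * g x)) / 2"
      using cosh_convex_comb[of "1/2" "\<gamma> * f x" "\<gamma> * g x"] by (simp add: field_simps)
    also have "\<dots> \<le> cosh (\<gamma> * f x) + cosh (\<gamma> * g x)"
      by (simp add: field_simps)
    finally show "cosh (\<gamma> / 2 * (f x + g x)) \<le> cosh (\<gamma> * f x) + cosh (\<gamma> * g x)" .
  qed simp
  then show ?thesis
    unfolding exp_class_def using \<open>\<gamma> > 0\<close> by (auto intro!: exI[of _ "\<gamma> / 2"])
qed

lemma exp_class_scale: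
  assumes f: "f \<in> exp_class"
  shows "(\<lambda>x. c * f x) \<in> exp_class"
proof -
  note [measurable] = exp_class_measurable[OF f]
  obtain \<alpha> where \<alpha>: "\<alpha> > 0" "integrable P (\<lambda>x. cosh (\<alpha> * f x))"
    using f by (auto simp: exp_class_def)
  \<comment> \<open>The \<open>+ 1\<close> only avoids a case distinction for \<open>c = 0\<close>.\<close>
  have "\<bar>\<alpha> / (\<bar>c\<bar> + 1) * (c * f x)\<bar> \<le> \<bar>\<alpha> * f x\<bar>" for x
  proof -
    have "\<alpha> * \<bar>f x\<bar> * (\<bar>c\<bar> / (\<bar>c\<bar> + 1)) \<le> \<alpha> * \<bar>f x\<bar> * 1"
      using \<alpha>(1) by (intro mult_left_mono) auto
    then show ?thesis using \<alpha>(1) by (simp add: abs_mult ac_simps)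
  qed
  then have "integrable P (\<lambda>x. cosh (\<alpha> / (\<bar>c\<bar> + 1) * (c * f x)))"
    by (intro integrable_cosh_bound[OF \<alpha>(2)]) auto
  then show ?thesis
    unfolding exp_class_def using \<alpha>(1) by (auto intro!: exI[of _ "\<alpha> / (\<bar>c\<bar> + 1)"])
qed

lemma exp_class_abs: "f \<in> exp_class \<Longrightarrow> (\<lambda>x. \<bar>f x\<bar>) \<in> exp_class"
proof -
  assume "f \<in> exp_class"
  then obtain \<alpha> where [measurable]: "f \<in> borel_measurable M"
    and \<alpha>: "\<alpha> > 0" "integrable P (\<lambda>x. cosh (\<alpha> * f x))"
    by (auto simp: exp_class_def)
  have "integrable P (\<lambda>x. cosh (\<alpha> * \<bar>f x\<bar>))"
    by (rule integrable_cosh_bound[OF \<alpha>(2)]) (auto simp: abs_mult)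
  then show ?thesis using \<alpha>(1) by (auto simp: exp_class_def)
qed

lemma exp_class_zero: "(\<lambda>x. 0) \<in> exp_class"
  using P_const(1)[of 1] by (auto simp: exp_class_def intro!: exI[of _ "1::real"])

lemma exp_class_sum:
  assumes "\<And>i. i \<in> I \<Longrightarrow> f i \<in> exp_class"
  shows "(\<lambda>x. \<Sum>i\<in>I. f i x) \<in> exp_class"
  using assms
  by (induction I rule: infinite_finite_induct) (simp_all add: exp_class_zero exp_class_add)

text \<open>The closed ball of radius \<open>r\<close> for the Luxemburg norm; as \<open>P\<close> has mass one, the bound
  \<open>E[cosh(f/r) - 1] \<le> 1\<close> becomes \<open>E[cosh(f/r)] \<le> 2\<close>. The topological statements about
  \<open>cumulant_interior\<close> are all proved with these balls.\<close>

definition lux_ball :: "real \<Rightarrow> ('a \<Rightarrow> real) set" where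
  "lux_ball r = {f \<in> borel_measurable M.
     integrable P (\<lambda>x. cosh (f x / r)) \<and> (\<integral>x. cosh (f x / r) \<partial>P) \<le> 2}"

lemma orlicz_norm_eq:
  assumes [measurable]: "f \<in> borel_measurable M"
  shows "orlicz_norm M p f = Inf {r. r > 0 \<and> f \<in> lux_ball r}"
proof -
  have "nn_mean M p (\<lambda>x. cosh (f x / r) - 1) \<le> 1 \<longleftrightarrow> f \<in> lux_ball r" for r
  proof (cases "integrable P (\<lambda>x. cosh (f x / r))")
    case True
    then have int: "integrable P (\<lambda>x. cosh (f x / r) - 1)"
      by (simp add: integrable_cosh_minus_one)
    have "nn_mean M p (\<lambda>x. cosh (f x / r) - 1) = ennreal (\<integral>x. cosh (f x / r) - 1 \<partial>P)"
      by (rule nn_mean_eq_integral[OF int]) (simp add: cosh_real_ge_1)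
    also have "(\<integral>x. cosh (f x / r) - 1 \<partial>P) = (\<integral>x. cosh (f x / r) \<partial>P) - 1"
      using True P_const[of 1] by simp
    finally show ?thesis
      using True by (simp add: lux_ball_def ennreal_le_1)
  next
    case False
    then have "\<not> nn_mean M p (\<lambda>x. cosh (f x / r) - 1) < \<infinity>"
      by (subst nn_mean_finite_iff) (auto simp: integrable_cosh_minus_one cosh_real_ge_1)
    then show ?thesis using False by (simp add: lux_ball_def top.not_eq_extremum[symmetric] top_unique)
  qed
  then show ?thesis by (simp add: orlicz_norm_def)
qed

lemma orlicz_norm_le:
  assumes "f \<in> lux_ball r" "r > 0"
  shows "orlicz_norm M p f \<le> r"
proof -
  have "f \<in> borel_measurable M" using assms(1) by (simp add: lux_ball_def)
  then show ?thesis
    using assms by (subst orlicz_norm_eq) (auto intro!: cInf_lower bdd_belowI[of _ 0])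
qed

lemma lux_ball_mono:
  assumes "f \<in> lux_ball r" "g \<in> borel_measurable M" "\<And>x. \<bar>g x / s\<bar> \<le> \<bar>f x / r\<bar>"
  shows "g \<in> lux_ball s"
proof -
  have f: "integrable P (\<lambda>x. cosh (f x / r))" "(\<integral>x. cosh (f x / r) \<partial>P) \<le> 2"
    using assms(1) by (auto simp: lux_ball_def)
  have g: "integrable P (\<lambda>x. cosh (g x / s))"
    using assms(2,3) by (intro integrable_cosh_bound[OF f(1)]) auto
  have "(\<integral>x. cosh (g x / s) \<partial>P) \<le> (\<integral>x. cosh (f x / r) \<partial>P)"
    using assms(3) by (intro integral_mono[OF g f(1)] cosh_mono_abs)
  then show ?thesis using f g assms(2) by (simp add: lux_ball_def)
qed

text \<open>If \<open>K = E[cosh(\<alpha> f)]\<close>, then convexity between the points \<open>0\<close> and \<open>\<alpha> f\<close> shows that dividing the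
  argument by \<open>K\<close> divides the excess over \<open>1\<close> by at least \<open>K\<close>, so the radius \<open>K / \<alpha>\<close> suffices.\<close>

lemma exp_class_in_lux_ball:
  assumes "f \<in> exp_class"
  obtains r where "r > 0" "f \<in> lux_ball r"
proof -
  note [measurable] = exp_class_measurable[OF assms]
  obtain \<alpha> where \<alpha>: "\<alpha> > 0" "integrable P (\<lambda>x. cosh (\<alpha> * f x))"
    using assms by (auto simp: exp_class_def)
  define K where "K = (\<integral>x. cosh (\<alpha> * f x) \<partial>P)"
  have "(\<integral>x. 1 \<partial>P) \<le> K"
    unfolding K_def by (intro integral_mono P_const \<alpha>) (simp add: cosh_real_ge_1)
  then have K: "K \<ge> 1" by (simp only: P_const)
  have le: "cosh (f x / (K / \<alpha>)) \<le> (1 - 1 / K) + 1 / K * cosh (\<alpha> * f x)" for x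
    using cosh_convex_comb[of "1 / K" 0 "\<alpha> * f x"] K by (simp add: mult.commute)
  have int: "integrable P (\<lambda>x. (1 - 1 / K) + 1 / K * cosh (\<alpha> * f x))"
    by (intro Bochner_Integration.integrable_add P_const integrable_mult_right \<alpha>)
  have int': "integrable P (\<lambda>x. cosh (f x / (K / \<alpha>)))"
    by (rule integrable_cosh_le[OF int _ le]) simp
  have "(\<integral>x. cosh (f x / (K / \<alpha>)) \<partial>P) \<le> (\<integral>x. (1 - 1 / K) + 1 / K * cosh (\<alpha> * f x) \<partial>P)"
    using le by (intro integral_mono int int')
  also have "\<dots> = (1 - 1 / K) + 1 / K * K"
    unfolding K_def using \<alpha>(2) P_const
    by (subst Bochner_Integration.integral_add) auto
  also have "\<dots> \<le> 2" using K by simp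
  finally show thesis
    using that[of "K / \<alpha>"] int' K \<alpha>(1) by (simp add: lux_ball_def)
qed

lemma orlicz_norm_less:
  assumes "f \<in> exp_class" "orlicz_norm M p f < e"
  obtains r where "0 < r" "r < e" "f \<in> lux_ball r"
proof -
  have "{r. r > 0 \<and> f \<in> lux_ball r} \<noteq> {}"
    using exp_class_in_lux_ball[OF assms(1)] by blast
  then have "\<exists>r\<in>{r. r > 0 \<and> f \<in> lux_ball r}. r < e"
    using assms exp_class_measurable by (intro cInf_lessD) (simp_all add: orlicz_norm_eq)
  then show thesis using that by auto
qed

text \<open>The triangle inequality of the Luxemburg norm: \<open>(f + g) / (r + s)\<close> is a convex combination of
  \<open>f / r\<close> and \<open>g / s\<close>.\<close>

lemma lux_ball_add:
  assumes f: "f \<in> lux_ball r" and g: "g \<in> lux_ball s" and "r > 0" "s > 0"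
  shows "(\<lambda>x. f x + g x) \<in> lux_ball (r + s)"
proof -
  have [measurable]: "f \<in> borel_measurable M" "g \<in> borel_measurable M"
    and int: "integrable P (\<lambda>x. cosh (f x / r))" "integrable P (\<lambda>x. cosh (g x / s))"
    and le2: "(\<integral>x. cosh (f x / r) \<partial>P) \<le> 2" "(\<integral>x. cosh (g x / s) \<partial>P) \<le> 2"
    using f g by (auto simp: lux_ball_def)
  define t where "t = s / (r + s)"
  have t: "0 \<le> t" "t \<le> 1" "1 - t = r / (r + s)"
    using assms(3,4) by (auto simp: t_def field_simps)
  let ?b = "\<lambda>x. (1 - t) * cosh (f x / r) + t * cosh (g x / s)"
  have "(f x + g x) / (r + s) = (1 - t) * (f x / r) + t * (g x / s)" for x
    unfolding t(3) using assms(3,4) by (simp add: t_def add_divide_distrib)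
  then have le: "cosh ((f x + g x) / (r + s)) \<le> ?b x" for x
    using cosh_convex_comb[OF t(1,2)] by metis
  have ib: "integrable P ?b" using int by simp
  have int': "integrable P (\<lambda>x. cosh ((f x + g x) / (r + s)))"
    by (rule integrable_cosh_le[OF ib _ le]) simp
  have "(\<integral>x. cosh ((f x + g x) / (r + s)) \<partial>P) \<le> (\<integral>x. ?b x \<partial>P)"
    using le by (intro integral_mono ib int')
  also have "\<dots> = (1 - t) * (\<integral>x. cosh (f x / r) \<partial>P) + t * (\<integral>x. cosh (g x / s) \<partial>P)"
    using int by simp
  also have "\<dots> \<le> (1 - t) * 2 + t * 2"
    using t le2 by (intro add_mono mult_left_mono) auto
  finally show ?thesis using int' by (simp add: lux_ball_def)
qed

lemma cumulant_dom_iff: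
  "f \<in> cumulant_dom M p \<longleftrightarrow> f \<in> orlicz_space M p \<and> integrable P (\<lambda>x. exp (f x))"
proof (cases "f \<in> orlicz_space M p")
  case True
  then have "f \<in> borel_measurable M" by (simp add: orlicz_space_def)
  then have "nn_mean M p (\<lambda>x. exp (f x)) < \<infinity> \<longleftrightarrow> integrable P (\<lambda>x. exp (f x))"
    by (intro nn_mean_finite_iff) auto
  then show ?thesis
    using True by (auto simp: cumulant_dom_def cumulant_def Let_def top.not_eq_extremum)
qed (simp add: cumulant_dom_def)

end

section \<open>The parameter domain\<close>

locale exponential_family = reference_density M p for M :: "'a measure" and p +
  fixes u :: "'d::finite \<Rightarrow> 'a \<Rightarrow> real"
  assumes u_orlicz: "\<And>j. u j \<in> orlicz_space M p"
    and u_indep: "lin_indep_L2 M p u"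
begin

abbreviation \<Theta> :: "(real^'d) set" where
  "\<Theta> \<equiv> par_space M p u"

abbreviation lc :: "real^'d \<Rightarrow> 'a \<Rightarrow> real" where
  "lc \<equiv> lin_comb u"

text \<open>A single function that controls all linear combinations \<open>\<theta>\<cdot>u\<close> and all polynomials in \<open>u\<close>.\<close>

definition total_abs :: "'a \<Rightarrow> real" where
  "total_abs x = (\<Sum>j\<in>UNIV. \<bar>u j x\<bar>)"

lemma u_measurable [measurable]: "u j \<in> borel_measurable M"
  using u_orlicz[of j] by (simp add: orlicz_space_def)

lemma lc_measurable [measurable]: "lc \<theta> \<in> borel_measurable M"
  unfolding lin_comb_def[abs_def] by measurable

lemma total_abs_measurable [measurable]: "total_abs \<in> borel_measurable M"
  unfolding total_abs_def[abs_def] by measurable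

lemma lc_add: "lc (\<theta> + \<theta>') x = lc \<theta> x + lc \<theta>' x"
  and lc_diff: "lc (\<theta> - \<theta>') x = lc \<theta> x - lc \<theta>' x"
  and lc_scale: "lc (c *\<^sub>R \<theta>) x = c * lc \<theta> x"
  by (simp_all add: lin_comb_def algebra_simps sum.distrib sum_subtractf sum_distrib_left)

lemma lc_axis: "lc (axis j c) x = c * u j x"
  by (simp add: lin_comb_def axis_def if_distrib[of "\<lambda>c. c * _"] cong: if_cong)

lemma total_abs_nonneg: "0 \<le> total_abs x"
  by (simp add: total_abs_def sum_nonneg)

lemma abs_u_le: "\<bar>u j x\<bar> \<le> total_abs x"
  unfolding total_abs_def by (rule member_le_sum) auto

lemma abs_lc_le: "\<bar>lc \<theta> x\<bar> \<le> norm \<theta> * total_abs x"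
proof -
  have "\<bar>lc \<theta> x\<bar> \<le> (\<Sum>j\<in>UNIV. \<bar>\<theta> $ j * u j x\<bar>)"
    unfolding lin_comb_def by (rule sum_abs)
  also have "\<dots> \<le> (\<Sum>j\<in>UNIV. norm \<theta> * \<bar>u j x\<bar>)"
    by (intro sum_mono) (simp add: abs_mult component_le_norm_cart mult_right_mono)
  finally show ?thesis by (simp add: total_abs_def sum_distrib_left)
qed

text \<open>Bounding \<open>total_abs\<close> by \<open>d\<close> times the largest \<open>|u j|\<close> reduces its exponential to finitely many
  exponentials of linear combinations, whose integrability is known on \<open>\<Theta>\<close>.\<close>

lemma exp_total_abs_le:
  assumes "a \<ge> 0"
  shows "exp (a * total_abs x)
    \<le> (\<Sum>j\<in>UNIV. exp (a * CARD('d) * u j x) + exp (- (a * CARD('d)) * u j x))"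
proof -
  have "Max (range (\<lambda>j. \<bar>u j x\<bar>)) \<in> range (\<lambda>j. \<bar>u j x\<bar>)"
    by (intro Max_in) auto
  then obtain i where i: "Max (range (\<lambda>j. \<bar>u j x\<bar>)) = \<bar>u i x\<bar>" by (rule rangeE)
  have "\<bar>u j x\<bar> \<le> \<bar>u i x\<bar>" for j
    unfolding i[symmetric] by (intro Max_ge) auto
  then have "total_abs x \<le> CARD('d) * \<bar>u i x\<bar>"
    unfolding total_abs_def using sum_bounded_above[of UNIV "\<lambda>j. \<bar>u j x\<bar>" "\<bar>u i x\<bar>"] by simp
  then have "a * total_abs x \<le> a * CARD('d) * \<bar>u i x\<bar>"
    using mult_left_mono[OF _ assms] by (simp add: mult.assoc)
  then have "exp (a * total_abs x) \<le> exp (a * CARD('d) * \<bar>u i x\<bar>)" by simp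
  also have "\<dots> \<le> exp (a * CARD('d) * u i x) + exp (- (a * CARD('d)) * u i x)"
    by (cases "u i x \<ge> 0") auto
  also have "\<dots> \<le> (\<Sum>j\<in>UNIV. exp (a * CARD('d) * u j x) + exp (- (a * CARD('d)) * u j x))"
    by (rule member_le_sum[where f = "\<lambda>j. exp (a * CARD('d) * u j x) + exp (- (a * CARD('d)) * u j x)"])
      (auto intro: add_nonneg_nonneg)
  finally show ?thesis .
qed

lemma u_exp_class: "u j \<in> exp_class" and u_mean_zero: "(\<integral>x. u j x \<partial>P) = 0"
  using u_orlicz[of j] by (simp_all add: orlicz_space_iff)

lemma lc_orlicz: "lc \<theta> \<in> orlicz_space M p"
  unfolding orlicz_space_iff
proof
  show "lc \<theta> \<in> exp_class"
    unfolding lin_comb_def[abs_def] by (intro exp_class_sum exp_class_scale u_exp_class)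
  show "(\<integral>x. lc \<theta> x \<partial>P) = 0"
    unfolding lin_comb_def using exp_class_integrable[OF u_exp_class]
    by (subst Bochner_Integration.integral_sum) (simp_all add: u_mean_zero)
qed

lemma orlicz_diff_lc:
  assumes "v \<in> orlicz_space M p"
  shows "(\<lambda>x. v x - lc \<theta> x) \<in> exp_class"
proof -
  have "(\<lambda>x. v x + lc (- \<theta>) x) \<in> exp_class"
    using assms lc_orlicz[of "- \<theta>"] by (intro exp_class_add) (auto simp: orlicz_space_iff)
  moreover have "lc (- \<theta>) x = - lc \<theta> x" for x
    by (simp add: lin_comb_def sum_negf)
  ultimately show ?thesis by simp
qed

text \<open>The map \<open>\<theta> \<mapsto> \<theta>\<cdot>u\<close> is bounded from \<open>\<real>\<^sup>d\<close> to the Orlicz space, since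
  \<open>|\<theta>\<cdot>u| \<le> norm \<theta> * total_abs\<close>.\<close>

lemma lc_lux_ball:
  "\<exists>R>0. \<forall>\<theta> r. 0 < r \<longrightarrow> norm \<theta> * R \<le> r \<longrightarrow> lc \<theta> \<in> lux_ball r"
proof -
  have "total_abs \<in> exp_class"
    unfolding total_abs_def[abs_def] by (intro exp_class_sum exp_class_abs u_exp_class)
  then obtain R where R: "R > 0" "total_abs \<in> lux_ball R"
    using exp_class_in_lux_ball by blast
  have "lc \<theta> \<in> lux_ball r" if "0 < r" "norm \<theta> * R \<le> r" for \<theta> r
  proof (rule lux_ball_mono[OF R(2)])
    fix x
    have "norm \<theta> / r \<le> 1 / R"
      using that R(1) by (simp add: field_simps)
    then have "norm \<theta> / r * total_abs x \<le> 1 / R * total_abs x"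
      by (rule mult_right_mono) (rule total_abs_nonneg)
    moreover have "\<bar>lc \<theta> x\<bar> / r \<le> norm \<theta> * total_abs x / r"
      using that(1) abs_lc_le by (intro divide_right_mono) auto
    ultimately show "\<bar>lc \<theta> x / r\<bar> \<le> \<bar>total_abs x / R\<bar>"
      using that(1) R(1) total_abs_nonneg[of x] by (simp add: abs_divide)
  qed simp
  then show ?thesis using R(1) by blast
qed

lemma exp_lc_integrable:
  assumes "\<theta> \<in> \<Theta>"
  shows "integrable P (\<lambda>x. exp (lc \<theta> x))"
proof -
  obtain e where e: "e > 0" "\<And>v. v \<in> orlicz_space M p \<Longrightarrow>
      orlicz_norm M p (\<lambda>x. v x - lc \<theta> x) < e \<Longrightarrow> v \<in> cumulant_dom M p"
    using assms by (auto simp: par_space_def cumulant_interior_def)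
  obtain R where R: "R > 0" "\<And>\<theta> r. 0 < r \<Longrightarrow> norm \<theta> * R \<le> r \<Longrightarrow> lc \<theta> \<in> lux_ball r"
    using lc_lux_ball by blast
  from R(2)[of "e / 2" 0] have "lc 0 \<in> lux_ball (e / 2)"
    using e(1) by simp
  moreover have "lc 0 = (\<lambda>x. lc \<theta> x - lc \<theta> x)"
    by (simp add: fun_eq_iff lin_comb_def)
  ultimately have "orlicz_norm M p (\<lambda>x. lc \<theta> x - lc \<theta> x) \<le> e / 2"
    using orlicz_norm_le[of "lc 0" "e / 2"] e(1) by simp
  then have "lc \<theta> \<in> cumulant_dom M p"
    using e lc_orlicz[of \<theta>] by simp
  then show ?thesis by (simp add: cumulant_dom_iff)
qed

text \<open>If the Orlicz ball of radius \<open>e\<close> around \<open>\<theta>\<cdot>u\<close> is in the domain, then by the triangle inequality so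
  is the ball of radius \<open>e / 2\<close> around \<open>\<theta>'\<cdot>u\<close> for all \<open>\<theta>'\<close> near \<open>\<theta>\<close>.\<close>

lemma open_par_space: "open \<Theta>"
  unfolding open_dist
proof
  fix \<theta> assume "\<theta> \<in> \<Theta>"
  then obtain e where e: "e > 0" "\<And>v. v \<in> orlicz_space M p \<Longrightarrow>
      orlicz_norm M p (\<lambda>x. v x - lc \<theta> x) < e \<Longrightarrow> v \<in> cumulant_dom M p"
    by (auto simp: par_space_def cumulant_interior_def)
  obtain R where R: "R > 0" "\<And>\<theta> r. 0 < r \<Longrightarrow> norm \<theta> * R \<le> r \<Longrightarrow> lc \<theta> \<in> lux_ball r"
    using lc_lux_ball by blast
  have "\<theta>' \<in> \<Theta>" if \<theta>': "dist \<theta>' \<theta> < e / (2 * R)" for \<theta>'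
  proof -
    have "norm (\<theta>' - \<theta>) * R \<le> e / 2"
      using \<theta>' R(1) by (simp add: dist_norm field_simps)
    then have shift: "lc (\<theta>' - \<theta>) \<in> lux_ball (e / 2)"
      using R(2) e(1) by simp
    have "v \<in> cumulant_dom M p"
      if v: "v \<in> orlicz_space M p" "orlicz_norm M p (\<lambda>x. v x - lc \<theta>' x) < e / 2" for v
    proof -
      obtain r where r: "0 < r" "r < e / 2" "(\<lambda>x. v x - lc \<theta>' x) \<in> lux_ball r"
        using orlicz_norm_less[OF orlicz_diff_lc[OF v(1)] v(2)] by blast
      have "(\<lambda>x. (v x - lc \<theta>' x) + lc (\<theta>' - \<theta>) x) \<in> lux_ball (r + e / 2)"
        using lux_ball_add[OF r(3) shift] r(1) e(1) by simp
      then have "(\<lambda>x. v x - lc \<theta> x) \<in> lux_ball (r + e / 2)"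
        by (simp add: lc_diff)
      then have "orlicz_norm M p (\<lambda>x. v x - lc \<theta> x) \<le> r + e / 2"
        using r(1) e(1) by (intro orlicz_norm_le) auto
      then show ?thesis using e(2) v(1) r(2) by simp
    qed
    then show ?thesis
      using e(1) lc_orlicz[of \<theta>'] unfolding par_space_def cumulant_interior_def
      by (auto intro!: exI[of _ "e / 2"])
  qed
  then show "\<exists>\<delta>>0. \<forall>\<theta>'. dist \<theta>' \<theta> < \<delta> \<longrightarrow> \<theta>' \<in> \<Theta>"
    using e(1) R(1) by (intro exI[of _ "e / (2 * R)"]) auto
qed

text \<open>The integrability reserve at interior points: the bounding exponentials belong to the parameters
  \<open>\<theta> \<plusminus> b e\<^sub>j\<close>, which are still in \<open>\<Theta>\<close> for small \<open>b\<close>.\<close>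

lemma exp_lc_total_abs_integrable:
  assumes "\<theta> \<in> \<Theta>"
  obtains a where "a > 0" "integrable P (\<lambda>x. exp (lc \<theta> x + a * total_abs x))"
proof -
  obtain e where e: "e > 0" "\<And>\<theta>'. dist \<theta>' \<theta> < e \<Longrightarrow> \<theta>' \<in> \<Theta>"
    using open_par_space assms unfolding open_dist by blast
  \<comment> \<open>\<open>exp_total_abs_le\<close> multiplies the exponent by the dimension; \<open>a\<close> compensates for this.\<close>
  define b where "b = e / 2"
  define a where "a = b / CARD('d)"
  have ab: "a > 0" "a * CARD('d) = b" "b > 0"
    using e(1) by (auto simp: a_def b_def)
  have int: "integrable P (\<lambda>x. exp (lc (\<theta> + axis j c) x))" if "\<bar>c\<bar> \<le> b" for j c
  proof -
    have "axis j c = c *\<^sub>R axis j (1::real)" by (simp add: vec_eq_iff axis_def)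
    then have "norm (axis j c) = \<bar>c\<bar>" by simp
    then show ?thesis
      using that e(1) by (intro exp_lc_integrable e(2)) (simp add: dist_norm b_def)
  qed
  let ?B = "\<lambda>x. \<Sum>j\<in>UNIV. exp (lc (\<theta> + axis j b) x) + exp (lc (\<theta> + axis j (- b)) x)"
  have "integrable P ?B"
    using ab(3) by (intro Bochner_Integration.integrable_sum Bochner_Integration.integrable_add int) auto
  then have "integrable P (\<lambda>x. exp (lc \<theta> x + a * total_abs x))"
  proof (rule Bochner_Integration.integrable_bound)
    have split: "exp (lc (\<theta> + axis j c) x) = exp (lc \<theta> x) * exp (c * u j x)" for j c x
      by (simp add: lc_add lc_axis exp_add)
    have "exp (lc \<theta> x + a * total_abs x) \<le> ?B x" for x
      using mult_left_mono[OF exp_total_abs_le[of a x], of "exp (lc \<theta> x)"] ab(1)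
      by (simp only: ab(2) split exp_add sum_distrib_left distrib_left) simp
    then show "AE x in P. norm (exp (lc \<theta> x + a * total_abs x)) \<le> norm (?B x)"
      by (intro AE_I2) (smt (verit, best) real_norm_def exp_gt_zero)
  qed measurable
  with ab(1) show thesis by (rule that)
qed

section \<open>Differentiation of exponential moments\<close>

text \<open>Functions smaller than every exponential of \<open>total_abs\<close>. They form an algebra that contains the
  constants and the \<open>u j\<close>, hence all polynomials in \<open>u\<close>, and their products with
  \<open>exp(\<theta>\<cdot>u)\<close> are integrable for \<open>\<theta> \<in> \<Theta>\<close>.\<close>

definition subexponential :: "('a \<Rightarrow> real) \<Rightarrow> bool" where
  "subexponential f \<longleftrightarrow> f \<in> borel_measurable M \<and> (\<forall>\<epsilon>>0. \<exists>C\<ge>0. \<forall>x. \<bar>f x\<bar> \<le> C * exp (\<epsilon> * total_abs x))"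

lemma subexponential_measurable: "subexponential f \<Longrightarrow> f \<in> borel_measurable M"
  by (simp add: subexponential_def)

lemma subexponential_bound:
  assumes "subexponential f" "\<epsilon> > 0"
  obtains C where "C \<ge> 0" "\<And>x. \<bar>f x\<bar> \<le> C * exp (\<epsilon> * total_abs x)"
  using assms unfolding subexponential_def by blast

lemma subexponential_const: "subexponential (\<lambda>x. c)"
  unfolding subexponential_def
proof (intro conjI allI impI)
  fix \<epsilon> :: real assume "\<epsilon> > 0"
  then have "1 \<le> exp (\<epsilon> * total_abs x)" for x
    using total_abs_nonneg[of x] by simp
  then have "\<bar>c\<bar> \<le> \<bar>c\<bar> * exp (\<epsilon> * total_abs x)" for x
    using mult_left_mono[of 1 "exp (\<epsilon> * total_abs x)" "\<bar>c\<bar>"] by simp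
  then show "\<exists>C\<ge>0. \<forall>x. \<bar>c\<bar> \<le> C * exp (\<epsilon> * total_abs x)"
    by (intro exI[of _ "\<bar>c\<bar>"]) auto
qed simp

lemma subexponential_linear_bound:
  assumes "f \<in> borel_measurable M" "\<And>x. \<bar>f x\<bar> \<le> K * total_abs x" "K \<ge> 0"
  shows "subexponential f"
  unfolding subexponential_def
proof (intro conjI allI impI)
  fix \<epsilon> :: real assume \<epsilon>: "\<epsilon> > 0"
  have "\<bar>f x\<bar> \<le> K / \<epsilon> * exp (\<epsilon> * total_abs x)" for x
  proof -
    have "\<epsilon> * total_abs x \<le> exp (\<epsilon> * total_abs x)"
      using exp_gt_self[of "\<epsilon> * total_abs x"] by simp
    then have "K / \<epsilon> * (\<epsilon> * total_abs x) \<le> K / \<epsilon> * exp (\<epsilon> * total_abs x)"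
      using assms(3) \<epsilon> by (intro mult_left_mono) auto
    then show ?thesis using assms(2)[of x] \<epsilon> by simp
  qed
  then show "\<exists>C\<ge>0. \<forall>x. \<bar>f x\<bar> \<le> C * exp (\<epsilon> * total_abs x)"
    using assms(3) \<epsilon> by (intro exI[of _ "K / \<epsilon>"]) auto
qed (rule assms)

lemma subexponential_u: "subexponential (u j)"
  using abs_u_le by (intro subexponential_linear_bound[of _ 1]) auto

lemma subexponential_lc: "subexponential (lc \<theta>)"
  using abs_lc_le by (intro subexponential_linear_bound[of _ "norm \<theta>"]) auto

lemma subexponential_total_abs: "subexponential total_abs"
  using total_abs_nonneg by (intro subexponential_linear_bound[of _ 1]) auto

lemma subexponential_mult:
  assumes f: "subexponential f" and g: "subexponential g"
  shows "subexponential (\<lambda>x. f x * g x)"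
  unfolding subexponential_def
proof (intro conjI allI impI)
  note [measurable] = subexponential_measurable[OF f] subexponential_measurable[OF g]
  show "(\<lambda>x. f x * g x) \<in> borel_measurable M" by measurable
  fix \<epsilon> :: real assume "\<epsilon> > 0"
  then have e2: "\<epsilon> / 2 > 0" by simp
  obtain C where C: "C \<ge> 0" "\<And>x. \<bar>f x\<bar> \<le> C * exp (\<epsilon> / 2 * total_abs x)"
    using subexponential_bound[OF f e2] by blast
  obtain D where D: "D \<ge> 0" "\<And>x. \<bar>g x\<bar> \<le> D * exp (\<epsilon> / 2 * total_abs x)"
    using subexponential_bound[OF g e2] by blast
  have "\<bar>f x * g x\<bar> \<le> C * D * exp (\<epsilon> * total_abs x)" for x
  proof -
    have "\<bar>f x * g x\<bar> \<le> (C * exp (\<epsilon> / 2 * total_abs x)) * (D * exp (\<epsilon> / 2 * total_abs x))"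
      unfolding abs_mult using C D by (intro mult_mono) auto
    also have "\<dots> = C * D * exp (\<epsilon> / 2 * total_abs x + \<epsilon> / 2 * total_abs x)"
      by (simp only: exp_add ac_simps)
    also have "\<epsilon> / 2 * total_abs x + \<epsilon> / 2 * total_abs x = \<epsilon> * total_abs x" by simp
    finally show ?thesis .
  qed
  then show "\<exists>C\<ge>0. \<forall>x. \<bar>f x * g x\<bar> \<le> C * exp (\<epsilon> * total_abs x)"
    using C D by (intro exI[of _ "C * D"]) auto
qed

lemma subexponential_add:
  assumes f: "subexponential f" and g: "subexponential g"
  shows "subexponential (\<lambda>x. f x + g x)"
  unfolding subexponential_def
proof (intro conjI allI impI)
  note [measurable] = subexponential_measurable[OF f] subexponential_measurable[OF g]
  show "(\<lambda>x. f x + g x) \<in> borel_measurable M" by measurable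
  fix \<epsilon> :: real assume \<epsilon>: "\<epsilon> > 0"
  obtain C where C: "C \<ge> 0" "\<And>x. \<bar>f x\<bar> \<le> C * exp (\<epsilon> * total_abs x)"
    using subexponential_bound[OF f \<epsilon>] by blast
  obtain D where D: "D \<ge> 0" "\<And>x. \<bar>g x\<bar> \<le> D * exp (\<epsilon> * total_abs x)"
    using subexponential_bound[OF g \<epsilon>] by blast
  have "\<bar>f x + g x\<bar> \<le> (C + D) * exp (\<epsilon> * total_abs x)" for x
    using C(2)[of x] D(2)[of x] by (simp add: distrib_right)
  then show "\<exists>C\<ge>0. \<forall>x. \<bar>f x + g x\<bar> \<le> C * exp (\<epsilon> * total_abs x)"
    using C D by (intro exI[of _ "C + D"]) auto
qed

lemmas subexponential_intros =
  subexponential_const subexponential_u subexponential_lc subexponential_total_abs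
  subexponential_mult subexponential_add

lemma subexponential_integrable_total_abs:
  assumes f: "subexponential f" and "b < a" and a: "integrable P (\<lambda>x. exp (lc \<theta> x + a * total_abs x))"
  shows "integrable P (\<lambda>x. \<bar>f x\<bar> * exp (lc \<theta> x + b * total_abs x))"
proof -
  note [measurable] = subexponential_measurable[OF f]
  obtain C where C: "C \<ge> 0" "\<And>x. \<bar>f x\<bar> \<le> C * exp ((a - b) * total_abs x)"
    using subexponential_bound[OF f, of "a - b"] \<open>b < a\<close> by auto
  have le: "\<bar>f x\<bar> * exp (lc \<theta> x + b * total_abs x) \<le> C * exp (lc \<theta> x + a * total_abs x)" for x
  proof -
    have "\<bar>f x\<bar> * exp (lc \<theta> x + b * total_abs x)
        \<le> C * exp ((a - b) * total_abs x) * exp (lc \<theta> x + b * total_abs x)"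
      using C(2)[of x] by (rule mult_right_mono) simp
    also have "\<dots> = C * exp ((a - b) * total_abs x + (lc \<theta> x + b * total_abs x))"
      by (simp add: exp_add)
    finally show ?thesis by (simp add: algebra_simps)
  qed
  show ?thesis
  proof (rule Bochner_Integration.integrable_bound[OF integrable_mult_right[OF a, of C]])
    show "AE x in P. norm (\<bar>f x\<bar> * exp (lc \<theta> x + b * total_abs x)) \<le> norm (C * exp (lc \<theta> x + a * total_abs x))"
      using le C(1) by (intro AE_I2) (simp add: abs_mult)
  qed measurable
qed

lemma subexponential_integrable:
  assumes "\<theta> \<in> \<Theta>" "subexponential f"
  shows "integrable P (\<lambda>x. f x * exp (lc \<theta> x))"
proof -
  note [measurable] = subexponential_measurable[OF assms(2)]
  obtain a where a: "a > 0" "integrable P (\<lambda>x. exp (lc \<theta> x + a * total_abs x))"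
    using exp_lc_total_abs_integrable[OF assms(1)] by blast
  have "integrable P (\<lambda>x. \<bar>f x\<bar> * exp (lc \<theta> x + 0 * total_abs x))"
    by (rule subexponential_integrable_total_abs[OF assms(2) a])
  then show ?thesis
    by (rule Bochner_Integration.integrable_bound) (auto simp: abs_mult)
qed

text \<open>The expectation of \<open>f\<close> under the unnormalised density \<open>exp(\<theta>\<cdot>u) p\<close>; for \<open>f = 1\<close> this is the
  partition function.\<close>

definition Z :: "('a \<Rightarrow> real) \<Rightarrow> real^'d \<Rightarrow> real" where
  "Z f \<theta> = (\<integral>x. f x * exp (lc \<theta> x) \<partial>P)"

lemma Z_add:
  "\<theta> \<in> \<Theta> \<Longrightarrow> subexponential f \<Longrightarrow> subexponential g \<Longrightarrow> Z (\<lambda>x. f x + g x) \<theta> = Z f \<theta> + Z g \<theta>"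
  unfolding Z_def by (simp add: distrib_right subexponential_integrable)

lemma Z_scale: "Z (\<lambda>x. c * f x) \<theta> = c * Z f \<theta>"
  unfolding Z_def by (simp add: mult.assoc)

lemma Z_sum:
  assumes "\<theta> \<in> \<Theta>" "\<And>i. i \<in> I \<Longrightarrow> subexponential (f i)"
  shows "Z (\<lambda>x. \<Sum>i\<in>I. f i x) \<theta> = (\<Sum>i\<in>I. Z (f i) \<theta>)"
  unfolding Z_def sum_distrib_right
  by (intro Bochner_Integration.integral_sum subexponential_integrable assms)

text \<open>For small \<open>h\<close> the integrand of the remainder is bounded by \<open>norm h\<^sup>2\<close> times the fixed integrable
  function \<open>|f| total_abs\<^sup>2 exp(\<theta>\<cdot>u + (a/2) total_abs)\<close>, half of the reserve \<open>a\<close> being spent on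
  \<open>exp |h\<cdot>u|\<close> and the rest on the subexponential factors. So the remainder is quadratic in \<open>h\<close>.\<close>

lemma Z_has_derivative:
  assumes \<theta>: "\<theta> \<in> \<Theta>" and f: "subexponential f"
  shows "(Z f has_derivative (\<lambda>v. Z (\<lambda>x. f x * lc v x) \<theta>)) (at \<theta>)"
proof -
  note [measurable] = subexponential_measurable[OF f]
  obtain a where a: "a > 0" "integrable P (\<lambda>x. exp (lc \<theta> x + a * total_abs x))"
    using exp_lc_total_abs_integrable[OF \<theta>] by blast
  obtain e where e: "e > 0" "\<And>\<theta>'. dist \<theta>' \<theta> < e \<Longrightarrow> \<theta>' \<in> \<Theta>"
    using open_par_space \<theta> unfolding open_dist by blast
  let ?B = "\<lambda>x. \<bar>f x * total_abs x * total_abs x\<bar> * exp (lc \<theta> x + a / 2 * total_abs x)"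
  have intB: "integrable P ?B"
    using a(1) by (intro subexponential_integrable_total_abs[OF _ _ a(2)] subexponential_intros f) auto
  define r where "r = min e (a / 2)"
  show ?thesis
  proof (rule has_derivative_quadratic_remainder[where r = r])
    have "linear (\<lambda>v. Z (\<lambda>x. f x * lc v x) \<theta>)"
    proof (rule linearI)
      fix v w c
      show "Z (\<lambda>x. f x * lc (v + w) x) \<theta> = Z (\<lambda>x. f x * lc v x) \<theta> + Z (\<lambda>x. f x * lc w x) \<theta>"
        by (subst Z_add[symmetric, OF \<theta>]) (auto intro!: subexponential_intros f simp: lc_add distrib_left)
      show "Z (\<lambda>x. f x * lc (c *\<^sub>R v) x) \<theta> = c *\<^sub>R Z (\<lambda>x. f x * lc v x) \<theta>"
        by (simp add: Z_scale[symmetric] lc_scale ac_simps)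
    qed
    then show "bounded_linear (\<lambda>v. Z (\<lambda>x. f x * lc v x) \<theta>)"
      by (simp add: linear_conv_bounded_linear)
    show "r > 0" using a(1) e(1) by (simp add: r_def)
    fix h :: "real^'d" assume h: "norm h < r"
    then have h\<Theta>: "\<theta> + h \<in> \<Theta>"
      by (intro e(2)) (simp add: dist_norm r_def)
    let ?R = "\<lambda>x. f x * exp (lc (\<theta> + h) x) - f x * exp (lc \<theta> x) - f x * lc h x * exp (lc \<theta> x)"
    have int: "integrable P (\<lambda>x. f x * exp (lc (\<theta> + h) x))" "integrable P (\<lambda>x. f x * exp (lc \<theta> x))"
        "integrable P (\<lambda>x. f x * lc h x * exp (lc \<theta> x))"
      by (intro subexponential_integrable h\<Theta> \<theta> subexponential_intros f)+
    then have intR: "integrable P ?R" by simp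
    have eq: "Z f (\<theta> + h) - Z f \<theta> - Z (\<lambda>x. f x * lc h x) \<theta> = (\<integral>x. ?R x \<partial>P)"
      unfolding Z_def using int by simp
    have le: "\<bar>?R x\<bar> \<le> (norm h)\<^sup>2 * ?B x" for x
    proof -
      have "?R x = f x * exp (lc \<theta> x) * (exp (lc h x) - 1 - lc h x)"
        by (simp add: lc_add exp_add algebra_simps)
      then have "\<bar>?R x\<bar> = \<bar>f x\<bar> * exp (lc \<theta> x) * \<bar>exp (lc h x) - 1 - lc h x\<bar>"
        by (simp add: abs_mult)
      also have "\<dots> \<le> \<bar>f x\<bar> * exp (lc \<theta> x) * ((norm h * total_abs x)\<^sup>2 * exp (a / 2 * total_abs x))"
      proof (rule mult_left_mono)
        have "norm h * total_abs x \<le> a / 2 * total_abs x"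
          using h total_abs_nonneg by (intro mult_right_mono) (auto simp: r_def)
        then have "exp \<bar>lc h x\<bar> \<le> exp (a / 2 * total_abs x)"
          using abs_lc_le[of h x] by simp
        moreover have "(lc h x)\<^sup>2 \<le> (norm h * total_abs x)\<^sup>2"
          using abs_lc_le[of h x] by (metis abs_ge_zero power2_abs power_mono)
        ultimately have "(lc h x)\<^sup>2 * exp \<bar>lc h x\<bar> \<le> (norm h * total_abs x)\<^sup>2 * exp (a / 2 * total_abs x)"
          by (intro mult_mono) auto
        then show "\<bar>exp (lc h x) - 1 - lc h x\<bar> \<le> (norm h * total_abs x)\<^sup>2 * exp (a / 2 * total_abs x)"
          using exp_remainder_le[of "lc h x"] by linarith
      qed simp
      also have "\<dots> = (norm h)\<^sup>2 * ?B x"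
        using total_abs_nonneg[of x] by (simp add: abs_mult exp_add power2_eq_square)
      finally show ?thesis .
    qed
    have "\<bar>\<integral>x. ?R x \<partial>P\<bar> \<le> (\<integral>x. \<bar>?R x\<bar> \<partial>P)"
      by (rule integral_abs_bound)
    also have "\<dots> \<le> (\<integral>x. (norm h)\<^sup>2 * ?B x \<partial>P)"
      using le intR intB by (intro integral_mono integrable_abs integrable_mult_right)
    also have "\<dots> = (\<integral>x. ?B x \<partial>P) * (norm h)\<^sup>2"
      by simp
    finally show "norm (Z f (\<theta> + h) - Z f \<theta> - Z (\<lambda>x. f x * lc h x) \<theta>) \<le> (\<integral>x. ?B x \<partial>P) * (norm h)\<^sup>2"
      by (simp add: eq)
  qed
qed

text \<open>The derivatives of \<open>Z f\<close> are again of the form \<open>Z g\<close>.\<close>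

lemma Ck_on_Z: "subexponential f \<Longrightarrow> Ck_on k \<Theta> (Z f)"
proof (induction k arbitrary: f)
  case 0
  then show ?case
    using Z_has_derivative by (auto intro!: continuous_at_imp_continuous_on has_derivative_continuous)
next
  case (Suc k)
  show ?case
    by (rule Ck_on_SucI[OF open_par_space Z_has_derivative])
      (auto intro!: Suc.IH subexponential_intros Suc.prems)
qed

section \<open>Expectations and covariances under the family\<close>

lemma Z_one_pos:
  assumes "\<theta> \<in> \<Theta>"
  shows "Z (\<lambda>x. 1) \<theta> > 0"
proof -
  have int: "integrable P (\<lambda>x. exp (lc \<theta> x))"
    by (rule exp_lc_integrable[OF assms])
  have "(\<integral>x. exp (lc \<theta> x) \<partial>P) \<noteq> 0"
  proof
    assume "(\<integral>x. exp (lc \<theta> x) \<partial>P) = 0"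
    then have "AE x in P. exp (lc \<theta> x) = 0"
      using integral_nonneg_eq_0_iff_AE[OF int] by simp
    then show False using AE_P_const[of False] by simp
  qed
  moreover have "(\<integral>x. exp (lc \<theta> x) \<partial>P) \<ge> 0"
    by (rule integral_nonneg_AE) simp
  ultimately have "(\<integral>x. exp (lc \<theta> x) \<partial>P) > 0" by linarith
  then show ?thesis by (simp add: Z_def)
qed

text \<open>The expectation under \<open>p\<^sub>\<theta>\<close> (\<open>mean_fam_density\<close>).\<close>

definition expect :: "('a \<Rightarrow> real) \<Rightarrow> real^'d \<Rightarrow> real" where
  "expect f \<theta> = Z f \<theta> / Z (\<lambda>x. 1) \<theta>"

lemma mean_fam_density:
  assumes "\<theta> \<in> \<Theta>" and [measurable]: "f \<in> borel_measurable M"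
  shows "mean M (fam_density M p u \<theta>) f = expect f \<theta>"
proof -
  let ?\<psi> = "log_partition M p u \<theta>"
  have "nn_mean M p (\<lambda>x. exp (lc \<theta> x)) = ennreal (Z (\<lambda>x. 1) \<theta>)"
    using nn_mean_eq_integral[OF exp_lc_integrable[OF assms(1)]] by (simp add: Z_def)
  then have "?\<psi> = ln (Z (\<lambda>x. 1) \<theta>)"
    using Z_one_pos[OF assms(1)] by (simp add: log_partition_def cumulant_def Let_def)
  then have \<psi>: "exp (- ?\<psi>) = 1 / Z (\<lambda>x. 1) \<theta>"
    using Z_one_pos[OF assms(1)] by (simp add: exp_minus divide_inverse)
  have "mean M (fam_density M p u \<theta>) f = mean M p (\<lambda>x. f x * exp (lc \<theta> x - ?\<psi>))"
    by (simp add: mean_def fam_density_def mult.assoc)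
  also have "\<dots> = (\<integral>x. f x * exp (lc \<theta> x - ?\<psi>) \<partial>P)"
    by (rule mean_eq) measurable
  also have "\<dots> = (\<integral>x. exp (- ?\<psi>) * (f x * exp (lc \<theta> x)) \<partial>P)"
    by (simp add: exp_diff exp_minus divide_inverse ac_simps)
  also have "\<dots> = exp (- ?\<psi>) * Z f \<theta>"
    by (simp add: Z_def)
  finally show ?thesis by (simp add: \<psi> expect_def)
qed

lemma expect_const: "\<theta> \<in> \<Theta> \<Longrightarrow> expect (\<lambda>x. c) \<theta> = c"
  using Z_scale[of c "\<lambda>x. 1" \<theta>] Z_one_pos[of \<theta>] by (simp add: expect_def)

lemma expect_add:
  "\<theta> \<in> \<Theta> \<Longrightarrow> subexponential f \<Longrightarrow> subexponential g
    \<Longrightarrow> expect (\<lambda>x. f x + g x) \<theta> = expect f \<theta> + expect g \<theta>"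
  by (simp add: expect_def Z_add add_divide_distrib)

lemma expect_scale: "expect (\<lambda>x. c * f x) \<theta> = c * expect f \<theta>"
  by (simp add: expect_def Z_scale)

lemma expect_sum:
  assumes "\<theta> \<in> \<Theta>" "\<And>i. i \<in> I \<Longrightarrow> subexponential (f i)"
  shows "expect (\<lambda>x. \<Sum>i\<in>I. f i x) \<theta> = (\<Sum>i\<in>I. expect (f i) \<theta>)"
  unfolding expect_def sum_divide_distrib[symmetric] by (simp only: Z_sum[OF assms])

lemma expect_lc_mult:
  assumes "\<theta> \<in> \<Theta>" "subexponential g"
  shows "expect (\<lambda>x. lc v x * g x) \<theta> = (\<Sum>j\<in>UNIV. v $ j * expect (\<lambda>x. u j x * g x) \<theta>)"
proof -
  have "(\<lambda>x. lc v x * g x) = (\<lambda>x. \<Sum>j\<in>UNIV. v $ j * (u j x * g x))"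
    by (simp add: fun_eq_iff lin_comb_def sum_distrib_right mult.assoc)
  then show ?thesis
    using expect_sum[OF assms(1), of UNIV "\<lambda>j x. v $ j * (u j x * g x)"]
    by (simp add: expect_scale subexponential_intros assms(2))
qed

lemma expect_square_eq_0:
  assumes \<theta>: "\<theta> \<in> \<Theta>" and f: "subexponential f"
  shows "expect (\<lambda>x. f x * f x) \<theta> \<ge> 0" and "expect (\<lambda>x. f x * f x) \<theta> = 0 \<Longrightarrow> AE x in P. f x = 0"
proof -
  have int: "integrable P (\<lambda>x. f x * f x * exp (lc \<theta> x))"
    by (intro subexponential_integrable \<theta> subexponential_intros f)
  show "expect (\<lambda>x. f x * f x) \<theta> \<ge> 0"
    unfolding expect_def Z_def by (intro divide_nonneg_nonneg integral_nonneg_AE) auto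
  assume "expect (\<lambda>x. f x * f x) \<theta> = 0"
  then have "(\<integral>x. f x * f x * exp (lc \<theta> x) \<partial>P) = 0"
    using Z_one_pos[OF \<theta>] by (simp add: expect_def Z_def)
  then have "AE x in P. f x * f x * exp (lc \<theta> x) = 0"
    using integral_nonneg_eq_0_iff_AE[OF int] by simp
  then show "AE x in P. f x = 0" by eventually_elim simp
qed

text \<open>The \<open>u j\<close> have mean zero, so a constant linear combination vanishes almost everywhere, and linear
  independence applies.\<close>

lemma lc_AE_const_imp_0:
  assumes "AE x in P. lc v x = c"
  shows "v = 0" "c = 0"
proof -
  have "(\<integral>x. lc v x \<partial>P) = (\<integral>x. c \<partial>P)"
    using assms by (intro integral_cong_AE) auto
  moreover have "(\<integral>x. lc v x \<partial>P) = 0"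
    using lc_orlicz[of v] by (simp add: orlicz_space_iff)
  ultimately show "c = 0"
    by (simp only: P_const)
  then show "v = 0"
    using u_indep assms unfolding lin_indep_L2_def by simp
qed

definition cov :: "('a \<Rightarrow> real) \<Rightarrow> ('a \<Rightarrow> real) \<Rightarrow> real^'d \<Rightarrow> real" where
  "cov f g \<theta> = expect (\<lambda>x. f x * g x) \<theta> - expect f \<theta> * expect g \<theta>"

text \<open>The variance \<open>E[(v\<cdot>u - m)\<^sup>2]\<close> vanishes only if \<open>v\<cdot>u\<close> is almost everywhere constant.\<close>

lemma cov_lc_pos:
  assumes \<theta>: "\<theta> \<in> \<Theta>" and "v \<noteq> 0"
  shows "cov (lc v) (lc v) \<theta> > 0"
proof -
  define m where "m = expect (lc v) \<theta>"
  let ?f = "\<lambda>x. lc v x + (- m)"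
  have f: "subexponential ?f" by (intro subexponential_intros)
  have "expect (\<lambda>x. ?f x * ?f x) \<theta> = expect (\<lambda>x. lc v x * lc v x + ((- 2 * m) * lc v x + m * m)) \<theta>"
    by (simp add: algebra_simps)
  also have "\<dots> = expect (\<lambda>x. lc v x * lc v x) \<theta> + ((- 2 * m) * m + m * m)"
    by (subst expect_add[OF \<theta>] expect_scale expect_const[OF \<theta>]; (intro subexponential_intros)?)+
      (simp add: m_def)
  also have "\<dots> = cov (lc v) (lc v) \<theta>"
    by (simp add: cov_def m_def)
  finally have eq: "expect (\<lambda>x. ?f x * ?f x) \<theta> = cov (lc v) (lc v) \<theta>" .
  have "\<not> (AE x in P. ?f x = 0)"
    using lc_AE_const_imp_0(1)[of v m] \<open>v \<noteq> 0\<close> by auto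
  then show ?thesis
    using expect_square_eq_0[OF \<theta> f] eq by (metis less_le)
qed

text \<open>The quotient rule for \<open>Z f / Z 1\<close>, the subtracted term coming from the normalisation.\<close>

lemma expect_has_derivative:
  assumes \<theta>: "\<theta> \<in> \<Theta>" and f: "subexponential f"
  shows "(expect f has_derivative (\<lambda>v. cov f (lc v) \<theta>)) (at \<theta>)"
proof -
  have pos: "Z (\<lambda>x. 1) \<theta> \<noteq> 0" using Z_one_pos[OF \<theta>] by simp
  show ?thesis
    unfolding expect_def[abs_def]
    using has_derivative_divide'[OF Z_has_derivative[OF \<theta> f] Z_has_derivative[OF \<theta> subexponential_const[of 1]] pos] pos
    by (simp add: cov_def expect_def diff_divide_distrib)
qed

lemma Ck_on_expect: "subexponential f \<Longrightarrow> Ck_on k \<Theta> (expect f)"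
  unfolding expect_def[abs_def] using Z_one_pos
  by (intro Ck_on_divide open_par_space Ck_on_Z subexponential_const) (auto simp: less_imp_neq[THEN not_sym])

section \<open>The mean map\<close>

definition mean_vec :: "real^'d \<Rightarrow> real^'d" where
  "mean_vec \<theta> = (\<chi> j. expect (u j) \<theta>)"

lemma Ck_on_mean_vec: "Ck_on k \<Theta> mean_vec"
  unfolding mean_vec_def[abs_def] by (intro Ck_on_vec_lambda open_par_space Ck_on_expect subexponential_u)

lemma mean_vec_has_derivative:
  assumes "\<theta> \<in> \<Theta>"
  shows "(mean_vec has_derivative (\<lambda>v. \<chi> j. cov (u j) (lc v) \<theta>)) (at \<theta>)"
  unfolding mean_vec_def[abs_def]
  by (intro has_derivative_vec_lambda expect_has_derivative assms subexponential_u)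

lemma expect_lc: "\<theta> \<in> \<Theta> \<Longrightarrow> expect (lc v) \<theta> = v \<bullet> mean_vec \<theta>"
  using expect_lc_mult[OF _ subexponential_const[of 1], of \<theta> v] by (simp add: inner_vec_def mean_vec_def)

text \<open>Pairing the derivative in direction \<open>v\<close> with \<open>v\<close> gives the variance of \<open>v\<cdot>u\<close>.\<close>

lemma mean_vec_derivative_inj:
  assumes \<theta>: "\<theta> \<in> \<Theta>" and "(\<chi> j. cov (u j) (lc v) \<theta>) = 0"
  shows "v = 0"
proof (rule ccontr)
  assume "v \<noteq> 0"
  have "cov (lc v) (lc v) \<theta> = (\<Sum>j\<in>UNIV. v $ j * cov (u j) (lc v) \<theta>)"
    using expect_lc_mult[OF \<theta> subexponential_lc] expect_lc[OF \<theta>]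
    by (simp add: cov_def inner_vec_def mean_vec_def right_diff_distrib sum_subtractf sum_distrib_right mult.assoc)
  also have "\<dots> = 0"
    using assms(2) by (simp add: vec_eq_iff)
  finally show False using cov_lc_pos[OF \<theta> \<open>v \<noteq> 0\<close>] by simp
qed

text \<open>Below, \<open>?g\<close> is the difference of the two densities relative to \<open>p\<close> and \<open>h\<close> the difference of
  their logarithms, so \<open>\<integral> ?g h\<close> is the symmetrised Kullback-Leibler divergence. It equals
  \<open>E\<^sub>\<theta>\<^sub>' h - E\<^sub>\<theta> h\<close>, and \<open>h\<close> is an affine function of \<open>u\<close>, so equal mean vectors make it vanish.\<close>

lemma inj_on_mean_vec: "inj_on mean_vec \<Theta>"
proof (rule inj_onI)
  fix \<theta> \<theta>' assume \<theta>: "\<theta> \<in> \<Theta>" "\<theta>' \<in> \<Theta>" and eq: "mean_vec \<theta> = mean_vec \<theta>'"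
  let ?Z = "Z (\<lambda>x. 1)"
  have pos: "?Z \<theta> > 0" "?Z \<theta>' > 0" using Z_one_pos \<theta> by auto
  define c where "c = ln (?Z \<theta>') - ln (?Z \<theta>)"
  define h where "h x = lc (\<theta>' - \<theta>) x + (- c)" for x
  have h: "subexponential h" unfolding h_def[abs_def] by (intro subexponential_intros)
  let ?g = "\<lambda>x. exp (lc \<theta>' x - ln (?Z \<theta>')) - exp (lc \<theta> x - ln (?Z \<theta>))"
  have int: "integrable P (\<lambda>x. h x * exp (lc \<theta> x))" "integrable P (\<lambda>x. h x * exp (lc \<theta>' x))"
    by (intro subexponential_integrable \<theta> h)+
  have gh: "?g x * h x = h x * exp (lc \<theta>' x) / ?Z \<theta>' - h x * exp (lc \<theta> x) / ?Z \<theta>" for x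
    using pos by (simp add: exp_diff algebra_simps)
  have "expect h \<theta> = expect h \<theta>'"
    unfolding h_def using \<theta> eq
    by (simp add: expect_add[OF _ subexponential_lc subexponential_const] expect_const[of _ "- c"] expect_lc
        del: add_uminus_conv_diff)
  then have "(\<integral>x. ?g x * h x \<partial>P) = 0"
    unfolding gh using int by (simp add: expect_def Z_def)
  moreover have "integrable P (\<lambda>x. ?g x * h x)"
    unfolding gh using int by simp
  moreover have hdiff: "h x = (lc \<theta>' x - ln (?Z \<theta>')) - (lc \<theta> x - ln (?Z \<theta>))" for x
    by (simp add: h_def c_def lc_diff)
  then have "0 \<le> ?g x * h x" for x
    using exp_diff_mult_diff_nonneg by metis
  ultimately have "AE x in P. ?g x * h x = 0"
    using integral_nonneg_eq_0_iff_AE[of P "\<lambda>x. ?g x * h x"] by simp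
  then have "AE x in P. lc (\<theta>' - \<theta>) x = c"
  proof eventually_elim
    case (elim x)
    then have "h x = 0" using hdiff[of x] by auto
    then show ?case by (simp add: h_def)
  qed
  then have "\<theta>' - \<theta> = 0" by (rule lc_AE_const_imp_0)
  then show "\<theta> = \<theta>'" by simp
qed

section \<open>The moment map in the chart\<close>

abbreviation moments :: "real^'d \<Rightarrow> real^('d option)^('d option)" where
  "moments \<theta> \<equiv> moment_map M u (fam_density M p u \<theta>)"

lemma subexponential_moment_vec: "subexponential (\<lambda>x. moment_vec u x $ i)"
  by (cases i) (simp_all add: moment_vec_def subexponential_intros)

lemma moments_nth:
  assumes "\<theta> \<in> \<Theta>"
  shows "moments \<theta> $ i $ j = expect (\<lambda>x. moment_vec u x $ i * moment_vec u x $ j) \<theta>"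
  unfolding moment_map_def
  using subexponential_mult[OF subexponential_moment_vec subexponential_moment_vec]
  by (simp add: mean_fam_density[OF assms] subexponential_measurable)

lemma Ck_on_moments: "Ck_on k \<Theta> moments"
proof (rule Ck_on_cong[OF open_par_space])
  show "Ck_on k \<Theta> (\<lambda>\<theta>. \<chi> i j. expect (\<lambda>x. moment_vec u x $ i * moment_vec u x $ j) \<theta>)"
    by (intro Ck_on_vec_lambda open_par_space Ck_on_expect subexponential_mult subexponential_moment_vec)
qed (simp add: vec_eq_iff moments_nth)

lemma moment_map_sym: "moment_map M u q \<in> sym_mat"
  by (simp add: sym_mat_def moment_map_def transpose_def mult.commute)

text \<open>The quadratic form at \<open>y\<close> is the second moment of the affine function \<open>f\<close> of \<open>u\<close> with coefficients \<open>y\<close>,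
  which is positive unless \<open>f\<close> vanishes almost everywhere.\<close>

lemma moments_spd:
  assumes \<theta>: "\<theta> \<in> \<Theta>"
  shows "moments \<theta> \<in> spd"
  unfolding spd_def
proof (intro CollectI conjI allI impI moment_map_sym)
  fix y :: "real^('d option)" assume "y \<noteq> 0"
  let ?V = "\<lambda>i x. moment_vec u x $ i"
  let ?v = "\<chi> j. y $ Some j"
  define f where "f x = lc ?v x + y $ None" for x
  have f: "subexponential f" unfolding f_def[abs_def] by (intro subexponential_intros)
  have fsum: "f x = (\<Sum>i\<in>UNIV. y $ i * ?V i x)" for x
    by (simp add: sum_option f_def lin_comb_def moment_vec_def)
  have V: "subexponential (\<lambda>x. y $ i * y $ j * (?V i x * ?V j x))" for i j
    by (intro subexponential_intros subexponential_moment_vec)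
  have "expect (\<lambda>x. f x * f x) \<theta>
      = expect (\<lambda>x. \<Sum>(i, j)\<in>UNIV \<times> UNIV. y $ i * y $ j * (?V i x * ?V j x)) \<theta>"
    unfolding fsum sum_product by (simp add: sum.cartesian_product ac_simps)
  also have "\<dots> = (\<Sum>(i, j)\<in>UNIV \<times> UNIV. y $ i * y $ j * moments \<theta> $ i $ j)"
    using expect_sum[OF \<theta>, of "UNIV \<times> UNIV" "\<lambda>(i, j) x. y $ i * y $ j * (?V i x * ?V j x)"] V
    by (simp add: split_beta expect_scale moments_nth[OF \<theta>])
  also have "\<dots> = (\<Sum>i\<in>UNIV. \<Sum>j\<in>UNIV. y $ i * y $ j * moments \<theta> $ i $ j)"
    by (rule sum.cartesian_product[symmetric])
  also have "\<dots> = y \<bullet> (moments \<theta> *v y)"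
    by (simp add: inner_vec_def matrix_vector_mult_def sum_distrib_left ac_simps)
  finally have eq: "expect (\<lambda>x. f x * f x) \<theta> = y \<bullet> (moments \<theta> *v y)" .
  have "\<not> (AE x in P. f x = 0)"
  proof
    assume "AE x in P. f x = 0"
    then have "AE x in P. lc ?v x = - y $ None"
      by eventually_elim (simp add: f_def)
    from lc_AE_const_imp_0[OF this] have "y $ i = 0" for i
      by (cases i) (simp_all add: vec_eq_iff)
    then show False using \<open>y \<noteq> 0\<close> by (simp add: vec_eq_iff)
  qed
  then show "0 < y \<bullet> (moments \<theta> *v y)"
    using expect_square_eq_0[OF \<theta> f] eq by (metis less_le)
qed

lemma last_column_moments: "\<theta> \<in> \<Theta> \<Longrightarrow> last_column (moments \<theta>) = mean_vec \<theta>"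
  by (simp add: last_column_def mean_vec_def moments_nth moment_vec_def)

lemma inj_on_moments: "inj_on moments \<Theta>"
  by (rule inj_onI) (metis inj_onD[OF inj_on_mean_vec] last_column_moments)

text \<open>The last column of the derivative is the derivative of \<open>mean_vec\<close>, which is injective.\<close>

lemma moments_immersion:
  assumes \<theta>: "\<theta> \<in> \<Theta>"
  shows "\<exists>D. (moments has_derivative D) (at \<theta>) \<and> range D \<subseteq> sym_mat \<and> dim (range D) = CARD('d)"
proof -
  obtain D where D: "(moments has_derivative D) (at \<theta>)"
    using Ck_on_SucD(1)[OF Ck_on_moments[of "Suc 0"] \<theta>] by blast
  have lin: "linear D" using D has_derivative_linear by blast
  \<comment> \<open>The moment map is fixed by transposition, hence so are the values of its derivative.\<close>
  have "bounded_linear (transpose :: real^('d option)^('d option) \<Rightarrow> _)"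
    unfolding linear_conv_bounded_linear[symmetric]
    by (auto intro!: linearI simp: transpose_def vec_eq_iff)
  from bounded_linear.has_derivative[OF this D]
  have "(moments has_derivative (\<lambda>v. transpose (D v))) (at \<theta>)"
    using moment_map_sym by (simp add: sym_mat_def)
  from has_derivative_unique[OF D this] have sym: "D v \<in> sym_mat" for v
    by (simp add: sym_mat_def fun_eq_iff)
  have "((\<lambda>\<theta>. last_column (moments \<theta>)) has_derivative (\<lambda>v. last_column (D v))) (at \<theta>)"
    using linear_last_column by (intro bounded_linear.has_derivative[OF _ D]) (simp add: linear_linear)
  then have "(mean_vec has_derivative (\<lambda>v. last_column (D v))) (at \<theta>)"
    by (rule has_derivative_transform_within_open[OF _ open_par_space \<theta>]) (rule last_column_moments)
  from has_derivative_unique[OF this mean_vec_has_derivative[OF \<theta>]]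
  have col: "last_column (D v) = (\<chi> j. cov (u j) (lc v) \<theta>)" for v
    by (simp add: fun_eq_iff)
  have "inj D"
    unfolding linear_injective_0[OF lin]
    using mean_vec_derivative_inj[OF \<theta>] col linear_0[OF linear_last_column] by metis
  then have "dim (range D) = CARD('d)"
    using dim_image_eq[OF lin, of UNIV] by (simp add: inj_on_subset)
  then show ?thesis using D sym by blast
qed

lemma mean_vec_inverse:
  shows "open (mean_vec ` \<Theta>)" and "Ck_on k (mean_vec ` \<Theta>) (inv_into \<Theta> mean_vec)"
  using smooth_inverse[OF open_par_space inj_on_mean_vec Ck_on_mean_vec mean_vec_has_derivative]
    mean_vec_derivative_inj by blast+

lemma embedded_submanifold_moments:
  "embedded_submanifold CARD('d) sym_mat spd (moments ` \<Theta>)"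
proof -
  let ?g = "inv_into \<Theta> mean_vec" and ?H = "mean_vec ` \<Theta>"
  have g: "?g h \<in> \<Theta>" "mean_vec (?g h) = h" if "h \<in> ?H" for h
    using that by (auto intro: inv_into_into f_inv_into_f)
  have "embedded_submanifold DIM(real^'d) sym_mat spd ((\<lambda>h. moments (?g h)) ` ?H)"
  proof (rule embedded_submanifold_section[OF subspace_sym_mat openin_spd linear_last_column
        linear_bordered bordered_sym last_column_bordered mean_vec_inverse(1)])
    show "Ck_on k ?H (\<lambda>h. moments (?g h))" for k
      using g(1) by (intro Ck_on_compose[OF mean_vec_inverse(1) open_par_space mean_vec_inverse(2) Ck_on_moments]) auto
  qed (use g moments_spd last_column_moments in auto)
  moreover have "(\<lambda>h. moments (?g h)) ` ?H = moments ` \<Theta>"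
    by (simp add: image_image inj_on_mean_vec cong: image_cong)
  ultimately show ?thesis by simp
qed

text \<open>Stated for an arbitrary left inverse \<open>r\<close>: on the image it agrees with \<open>mean_vec\<^sup>-\<^sup>1 \<circ> last_column\<close>,
  which is smooth on an open set of matrices.\<close>

lemma smooth_on_moments_inverse:
  assumes "\<And>\<theta>. \<theta> \<in> \<Theta> \<Longrightarrow> r (moments \<theta>) = \<theta>"
  shows "smooth_on (moments ` \<Theta>) r"
proof (rule smooth_onI)
  let ?Q = "last_column -` (mean_vec ` \<Theta>) :: (real^('d option)^('d option)) set"
  have bl: "bounded_linear (last_column :: real^('d option)^('d option) \<Rightarrow> real^'d)"
    using linear_last_column by (simp add: linear_linear)
  show op: "open ?Q"
    by (intro open_vimage mean_vec_inverse(1) linear_continuous_on bl)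
  show "moments ` \<Theta> \<subseteq> ?Q" using last_column_moments by auto
  show "Ck_on k ?Q (\<lambda>A. inv_into \<Theta> mean_vec (last_column A))" for k
    by (rule Ck_on_compose[OF op mean_vec_inverse(1) Ck_on_bounded_linear[OF bl op] mean_vec_inverse(2)]) auto
  show "inv_into \<Theta> mean_vec (last_column A) = r A" if "A \<in> moments ` \<Theta>" for A
    using that assms by (auto simp: last_column_moments inj_on_mean_vec)
qed

end

section \<open>The moment map is a diffeomorphism onto an embedded submanifold\<close>

theorem theorem5p3:
  fixes M :: "'a measure"
    and p :: "'a \<Rightarrow> real"
    and u :: "'d::finite \<Rightarrow> 'a \<Rightarrow> real"
  assumes "sigma_finite_measure M"
    and "p \<in> densities M"
    and "\<And>j. u j \<in> orlicz_space M p"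
    and "lin_indep_L2 M p u"
  shows
    \<comment> \<open>\<open>p\<^sub>\<theta> \<mapsto> \<theta>\<close> is a global chart with open range, and the moment map takes values in SPD\<close>
    "open (par_space M p u) \<and> inj_on (fam_density M p u) (par_space M p u) \<and>
     moment_map M u ` exp_family M p u \<subseteq> spd \<and>
     \<comment> \<open>(i) injectivity\<close>
     inj_on (moment_map M u) (exp_family M p u) \<and>
     \<comment> \<open>(ii) smoothness, in the chart\<close>
     smooth_on (par_space M p u) (\<lambda>\<theta>. moment_map M u (fam_density M p u \<theta>)) \<and>
     \<comment> \<open>(iii) immersion, in the chart\<close>
     (\<forall>\<theta> \<in> par_space M p u. \<exists>D.
        ((\<lambda>\<theta>. moment_map M u (fam_density M p u \<theta>)) has_derivative D) (at \<theta>) \<and>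
        range D \<subseteq> sym_mat \<and> dim (range D) = CARD('d)) \<and>
     \<comment> \<open>(iv) the image is an embedded submanifold, and the inverse of the moment map is smooth on it\<close>
     embedded_submanifold CARD('d) sym_mat spd (moment_map M u ` exp_family M p u) \<and>
     bij_betw (moment_map M u) (exp_family M p u) (moment_map M u ` exp_family M p u) \<and>
     smooth_on (moment_map M u ` exp_family M p u)
       (\<lambda>A. fam_chart M p u (inv_into (exp_family M p u) (moment_map M u) A))"
proof -
  interpret exponential_family M p u
    by unfold_locales (fact assms)+
  let ?S = "moment_map M u" and ?N = "exp_family M p u" and ?p = "fam_density M p u"
  have image: "?S ` ?N = moments ` \<Theta>"
    by (simp add: exp_family_def image_image)
  have inj_p: "inj_on ?p \<Theta>"
    by (rule inj_onI) (use inj_onD[OF inj_on_moments] in auto)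
  have inj_S: "inj_on ?S ?N"
    unfolding exp_family_def by (rule inj_onI) (use inj_onD[OF inj_on_moments] in auto)
  have "fam_chart M p u (inv_into ?N ?S (moments \<theta>)) = \<theta>" if "\<theta> \<in> \<Theta>" for \<theta>
    using that inj_p inj_S by (simp add: exp_family_def fam_chart_def)
  then have "smooth_on (?S ` ?N) (\<lambda>A. fam_chart M p u (inv_into ?N ?S A))"
    unfolding image by (rule smooth_on_moments_inverse)
  moreover have "?S ` ?N \<subseteq> spd"
    unfolding image using moments_spd by auto
  moreover have "smooth_on \<Theta> moments"
    by (rule smooth_onI[OF open_par_space _ Ck_on_moments]) auto
  moreover have "embedded_submanifold CARD('d) sym_mat spd (?S ` ?N)"
    unfolding image by (rule embedded_submanifold_moments)
  ultimately show ?thesis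
    using open_par_space inj_p inj_S moments_immersion by (auto simp: bij_betw_def)
qed

end
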